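(* Given a Dirac structure $L$ on a smooth manifold $M$, the dimensions of the leaves of its associated pre-symplectic foliation have the same parity.
   Context: On $TM\oplus T^*M$ consider the symmetric pairing $\langle (X_1,\alpha_1),(X_2,\alpha_2)\rangle=\frac12(i_{X_2}\alpha_1+i_{X_1}\alpha_2)$, and on $\Gamma(TM\oplus T^*M)$ the Courant bracket $[(X_1,\alpha_1),(X_2,\alpha_2)]=([X_1,X_2],\ \mathcal L_{X_1}\alpha_2-i_{X_2}d\alpha_1)$. A Dirac structure on $M$ is a smooth vector subbundle $L\subset TM\oplus T^*M$ that is maximal isotropic for $\langle\cdot,\cdot\rangle$ and such that $\Gamma(L)$ is closed under the Courant bracket. The distribution $(\mathcal D_L)_x=pr_1(L_x)\subset T_xM$ ($pr_1$ the projection to $TM$) integrates to a singular foliation, the pre-symplectic foliation associated with $L$; the leaf through $x$ has dimension $\dim(\mathcal D_L)_x$.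
   Formalization: The smooth manifold M is assumed connected; otherwise the claim fails, e.g. on two disjoint copies of R with L = TM on one and L = T*M on the other, whose leaves have dimensions 1 and 0. *)

theory Defs
  imports "HOL-Analysis.Analysis" "HOL-Library.Function_Algebras"
begin

section \<open>Pointwise real vector space structure on functions\<close>

instantiation "fun" :: (type, scaleR) scaleR
begin

definition scaleR_fun_def: "r *\<^sub>R f = (\<lambda>x. r *\<^sub>R f x)"

instance ..

end

instance "fun" :: (type, real_vector) real_vector
  by standard (simp_all add: scaleR_fun_def fun_eq_iff algebra_simps)


section \<open>Smooth manifolds\<close>

text \<open>
  The model space of a manifold is a linear subspace \<open>F\<close> of a Euclidean type, and the dimension of
  the manifold is \<open>dim F\<close>. Since the dimension is thus a natural number and not a type, zero
  included, the same notion serves for an ambient manifold and for submanifolds of any dimension.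

  \<open>C_k_on k F U f\<close> is meant for sets \<open>U\<close> that are open in \<open>F\<close>. There the derivative of \<open>f\<close> within
  \<open>U\<close> is uniquely determined in the directions of \<open>F\<close>, which are the only ones used.
\<close>

primrec C_k_on ::
  "nat \<Rightarrow> 'e::real_normed_vector set \<Rightarrow> 'e set \<Rightarrow> ('e \<Rightarrow> 'b::real_normed_vector) \<Rightarrow> bool"
where
  "C_k_on 0 F U f \<longleftrightarrow> continuous_on U f"
| "C_k_on (Suc k) F U f \<longleftrightarrow>
     (\<forall>x\<in>U. f differentiable (at x within U)) \<and>
     (\<forall>v\<in>F. C_k_on k F U (\<lambda>x. frechet_derivative f (at x within U) v))"

definition smooth_on ::
  "'e::real_normed_vector set \<Rightarrow> 'e set \<Rightarrow> ('e \<Rightarrow> 'b::real_normed_vector) \<Rightarrow> bool"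
where
  "smooth_on F U f \<longleftrightarrow> (\<forall>k. C_k_on k F U f)"

text \<open>
  A chart is a pair of its domain and its coordinate map, whose values outside the domain are
  irrelevant.
\<close>

type_synonym ('a, 'e) chart = "'a set \<times> ('a \<Rightarrow> 'e)"

definition chart_inv :: "('a, 'e) chart \<Rightarrow> 'e \<Rightarrow> 'a"
  where "chart_inv c = inv_into (fst c) (snd c)"

text \<open>
  The atlas need not be maximal: nothing below changes when an atlas is replaced by the maximal
  atlas that contains it.
\<close>

record ('a, 'e) manifold =
  mtop :: "'a topology"
  mmodel :: "'e set"
  matlas :: "('a, 'e) chart set"

definition second_countable_space :: "'a topology \<Rightarrow> bool"
  where "second_countable_space T \<longleftrightarrow>
    (\<exists>\<B>. countable \<B> \<and> (\<forall>B\<in>\<B>. openin T B) \<and>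
      (\<forall>U. openin T U \<longrightarrow> (\<exists>\<U>\<subseteq>\<B>. U = \<Union>\<U>)))"

definition is_chart :: "'a topology \<Rightarrow> 'e::euclidean_space set \<Rightarrow> ('a, 'e) chart \<Rightarrow> bool"
  where "is_chart T F c \<longleftrightarrow>
    openin T (fst c) \<and>
    openin (top_of_set F) (snd c ` fst c) \<and>
    homeomorphic_map (subtopology T (fst c)) (top_of_set (snd c ` fst c)) (snd c)"

definition smooth_manifold :: "('a, 'e::euclidean_space) manifold \<Rightarrow> bool"
  where "smooth_manifold M \<longleftrightarrow>
    Hausdorff_space (mtop M) \<and>
    second_countable_space (mtop M) \<and>
    subspace (mmodel M) \<and>
    (\<forall>c\<in>matlas M. is_chart (mtop M) (mmodel M) c) \<and>
    (\<Union>c\<in>matlas M. fst c) = topspace (mtop M) \<and>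
    (\<forall>c\<in>matlas M. \<forall>d\<in>matlas M.
       smooth_on (mmodel M) (snd c ` (fst c \<inter> fst d)) (snd d \<circ> chart_inv c))"

definition mdim :: "('a, 'e::euclidean_space) manifold \<Rightarrow> nat"
  where "mdim M = dim (mmodel M)"

definition charts_at :: "('a, 'e) manifold \<Rightarrow> 'a \<Rightarrow> ('a, 'e) chart set"
  where "charts_at M p = {c \<in> matlas M. p \<in> fst c}"

definition some_chart :: "('a, 'e) manifold \<Rightarrow> 'a \<Rightarrow> ('a, 'e) chart"
  where "some_chart M p = (SOME c. c \<in> charts_at M p)"

text \<open>The derivative at \<open>p\<close> of \<open>f\<close>, expressed in the chart \<open>c\<close>, in the coordinate direction \<open>e\<close>.\<close>

definition chart_deriv ::
  "('a, 'e::euclidean_space) chart \<Rightarrow> ('a \<Rightarrow> 'b::real_normed_vector) \<Rightarrow> 'a \<Rightarrow> 'e \<Rightarrow> 'b"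
  where "chart_deriv c f p e =
    frechet_derivative (f \<circ> chart_inv c) (at (snd c p) within snd c ` fst c) e"


section \<open>Tangent and cotangent spaces\<close>

text \<open>
  A tangent vector at \<open>p\<close> is the family of its coordinate expressions in all charts around \<open>p\<close>,
  related by the derivatives of the coordinate changes (and \<open>0\<close> at the other charts). A covector
  is a linear functional on the tangent space (and \<open>0\<close> elsewhere).
\<close>

type_synonym ('a, 'e) tangent = "('a, 'e) chart \<Rightarrow> 'e"
type_synonym ('a, 'e) cotangent = "('a, 'e) tangent \<Rightarrow> real"
type_synonym ('a, 'e) gen_tangent = "('a, 'e) tangent \<times> ('a, 'e) cotangent"

definition tangent_space ::
  "('a, 'e::euclidean_space) manifold \<Rightarrow> 'a \<Rightarrow> ('a, 'e) tangent set"
  where "tangent_space M p = {v.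
    (\<forall>c\<in>charts_at M p. v c \<in> mmodel M) \<and>
    (\<forall>c\<in>charts_at M p. \<forall>d\<in>charts_at M p. v d = chart_deriv c (snd d) p (v c)) \<and>
    (\<forall>c. c \<notin> charts_at M p \<longrightarrow> v c = 0)}"

definition cotangent_space ::
  "('a, 'e::euclidean_space) manifold \<Rightarrow> 'a \<Rightarrow> ('a, 'e) cotangent set"
  where "cotangent_space M p = {\<alpha>.
    (\<forall>v\<in>tangent_space M p. \<forall>w\<in>tangent_space M p. \<alpha> (v + w) = \<alpha> v + \<alpha> w) \<and>
    (\<forall>r. \<forall>v\<in>tangent_space M p. \<alpha> (r *\<^sub>R v) = r * \<alpha> v) \<and>
    (\<forall>v. v \<notin> tangent_space M p \<longrightarrow> \<alpha> v = 0)}"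

text \<open>The tangent vector at \<open>p\<close> whose coordinate expression in the chart \<open>c\<close> is \<open>e\<close>.\<close>

definition coord_vec ::
  "('a, 'e::euclidean_space) manifold \<Rightarrow> ('a, 'e) chart \<Rightarrow> 'a \<Rightarrow> 'e \<Rightarrow> ('a, 'e) tangent"
  where "coord_vec M c p e =
    (\<lambda>d. if d \<in> charts_at M p then chart_deriv c (snd d) p e else 0)"

definition smooth_vector_field_on ::
  "('a, 'e::euclidean_space) manifold \<Rightarrow> 'a set \<Rightarrow> ('a \<Rightarrow> ('a, 'e) tangent) \<Rightarrow> bool"
  where "smooth_vector_field_on M W X \<longleftrightarrow>
    (\<forall>p\<in>W. X p \<in> tangent_space M p) \<and>
    (\<forall>c\<in>matlas M.
       smooth_on (mmodel M) (snd c ` (fst c \<inter> W)) (\<lambda>x. X (chart_inv c x) c))"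

definition smooth_one_form_on ::
  "('a, 'e::euclidean_space) manifold \<Rightarrow> 'a set \<Rightarrow> ('a \<Rightarrow> ('a, 'e) cotangent) \<Rightarrow> bool"
  where "smooth_one_form_on M W \<alpha> \<longleftrightarrow>
    (\<forall>p\<in>W. \<alpha> p \<in> cotangent_space M p) \<and>
    (\<forall>c\<in>matlas M. \<forall>e\<in>mmodel M.
       smooth_on (mmodel M) (snd c ` (fst c \<inter> W))
         (\<lambda>x. \<alpha> (chart_inv c x) (coord_vec M c (chart_inv c x) e)))"


section \<open>Lie bracket, Lie derivative, exterior derivative\<close>

text \<open>
  These are the usual coordinate formulas
    \<open>[X, Y]\<^sup>j = X\<^sup>i \<partial>\<^sub>i Y\<^sup>j - Y\<^sup>i \<partial>\<^sub>i X\<^sup>j\<close>,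
    \<open>(L\<^sub>X \<alpha>)\<^sub>j = X\<^sup>i \<partial>\<^sub>i \<alpha>\<^sub>j + \<alpha>\<^sub>i \<partial>\<^sub>j X\<^sup>i\<close> and
    \<open>(d \<alpha>)\<^sub>i\<^sub>j = \<partial>\<^sub>i \<alpha>\<^sub>j - \<partial>\<^sub>j \<alpha>\<^sub>i\<close>,
  whose values do not depend on the chart.
\<close>

definition lie_bracket ::
  "('a, 'e::euclidean_space) manifold \<Rightarrow> ('a \<Rightarrow> ('a, 'e) tangent) \<Rightarrow> ('a \<Rightarrow> ('a, 'e) tangent)
    \<Rightarrow> 'a \<Rightarrow> ('a, 'e) tangent"
  where "lie_bracket M X Y p = (\<lambda>c.
    if c \<in> charts_at M p
    then chart_deriv c (\<lambda>q. Y q c) p (X p c) - chart_deriv c (\<lambda>q. X q c) p (Y p c)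
    else 0)"

definition lie_derivative ::
  "('a, 'e::euclidean_space) manifold \<Rightarrow> ('a \<Rightarrow> ('a, 'e) tangent) \<Rightarrow> ('a \<Rightarrow> ('a, 'e) cotangent)
    \<Rightarrow> 'a \<Rightarrow> ('a, 'e) cotangent"
  where "lie_derivative M X \<alpha> p = (\<lambda>w.
    if w \<in> tangent_space M p
    then let c = some_chart M p in
      chart_deriv c (\<lambda>q. \<alpha> q (coord_vec M c q (w c))) p (X p c)
      + \<alpha> p (coord_vec M c p (chart_deriv c (\<lambda>q. X q c) p (w c)))
    else 0)"

definition ext_derivative ::
  "('a, 'e::euclidean_space) manifold \<Rightarrow> ('a \<Rightarrow> ('a, 'e) cotangent)
    \<Rightarrow> 'a \<Rightarrow> ('a, 'e) tangent \<Rightarrow> ('a, 'e) tangent \<Rightarrow> real"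
  where "ext_derivative M \<alpha> p v w =
    (if v \<in> tangent_space M p \<and> w \<in> tangent_space M p
     then let c = some_chart M p in
       chart_deriv c (\<lambda>q. \<alpha> q (coord_vec M c q (w c))) p (v c)
       - chart_deriv c (\<lambda>q. \<alpha> q (coord_vec M c q (v c))) p (w c)
     else 0)"


section \<open>Dirac structures\<close>

definition gen_tangent_space ::
  "('a, 'e::euclidean_space) manifold \<Rightarrow> 'a \<Rightarrow> ('a, 'e) gen_tangent set"
  where "gen_tangent_space M p = tangent_space M p \<times> cotangent_space M p"

definition pairing :: "('a, 'e) gen_tangent \<Rightarrow> ('a, 'e) gen_tangent \<Rightarrow> real"
  where "pairing z1 z2 = 1/2 * (snd z1 (fst z2) + snd z2 (fst z1))"

definition isotropic :: "('a, 'e) gen_tangent set \<Rightarrow> bool"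
  where "isotropic A \<longleftrightarrow> (\<forall>z1\<in>A. \<forall>z2\<in>A. pairing z1 z2 = 0)"

definition maximal_isotropic ::
  "('a, 'e::euclidean_space) manifold \<Rightarrow> 'a \<Rightarrow> ('a, 'e) gen_tangent set \<Rightarrow> bool"
  where "maximal_isotropic M p A \<longleftrightarrow>
    subspace A \<and> A \<subseteq> gen_tangent_space M p \<and> isotropic A \<and>
    (\<forall>B. subspace B \<and> B \<subseteq> gen_tangent_space M p \<and> isotropic B \<and> A \<subseteq> B \<longrightarrow> B = A)"

definition smooth_section_on ::
  "('a, 'e::euclidean_space) manifold \<Rightarrow> 'a set \<Rightarrow> ('a \<Rightarrow> ('a, 'e) gen_tangent) \<Rightarrow> bool"
  where "smooth_section_on M W s \<longleftrightarrow>
    smooth_vector_field_on M W (\<lambda>p. fst (s p)) \<and> smooth_one_form_on M W (\<lambda>p. snd (s p))"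

definition smooth_subbundle ::
  "('a, 'e::euclidean_space) manifold \<Rightarrow> ('a \<Rightarrow> ('a, 'e) gen_tangent set) \<Rightarrow> bool"
  where "smooth_subbundle M L \<longleftrightarrow>
    (\<forall>p\<in>topspace (mtop M). subspace (L p) \<and> L p \<subseteq> gen_tangent_space M p) \<and>
    (\<forall>p\<in>topspace (mtop M). \<exists>W r (s :: nat \<Rightarrow> 'a \<Rightarrow> ('a, 'e) gen_tangent).
       openin (mtop M) W \<and> p \<in> W \<and>
       (\<forall>i<r. smooth_section_on M W (s i)) \<and>
       (\<forall>q\<in>W. inj_on (\<lambda>i. s i q) {..<r} \<and> independent ((\<lambda>i. s i q) ` {..<r}) \<and>
               span ((\<lambda>i. s i q) ` {..<r}) = L q))"

definition sections ::
  "('a, 'e::euclidean_space) manifold \<Rightarrow> ('a \<Rightarrow> ('a, 'e) gen_tangent set)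
    \<Rightarrow> ('a \<Rightarrow> ('a, 'e) gen_tangent) set"
  where "sections M L =
    {s. smooth_section_on M (topspace (mtop M)) s \<and> (\<forall>p\<in>topspace (mtop M). s p \<in> L p)}"

definition courant_bracket ::
  "('a, 'e::euclidean_space) manifold \<Rightarrow> ('a \<Rightarrow> ('a, 'e) gen_tangent)
    \<Rightarrow> ('a \<Rightarrow> ('a, 'e) gen_tangent) \<Rightarrow> 'a \<Rightarrow> ('a, 'e) gen_tangent"
  where "courant_bracket M s1 s2 p =
    (let X1 = (\<lambda>q. fst (s1 q)); \<alpha>1 = (\<lambda>q. snd (s1 q));
         X2 = (\<lambda>q. fst (s2 q)); \<alpha>2 = (\<lambda>q. snd (s2 q))
     in (lie_bracket M X1 X2 p,
         lie_derivative M X1 \<alpha>2 p - ext_derivative M \<alpha>1 p (X2 p)))"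

definition dirac_structure ::
  "('a, 'e::euclidean_space) manifold \<Rightarrow> ('a \<Rightarrow> ('a, 'e) gen_tangent set) \<Rightarrow> bool"
  where "dirac_structure M L \<longleftrightarrow>
    smooth_subbundle M L \<and>
    (\<forall>p\<in>topspace (mtop M). maximal_isotropic M p (L p)) \<and>
    (\<forall>s1\<in>sections M L. \<forall>s2\<in>sections M L. courant_bracket M s1 s2 \<in> sections M L)"

definition dirac_distribution ::
  "('a \<Rightarrow> ('a, 'e) gen_tangent set) \<Rightarrow> 'a \<Rightarrow> ('a, 'e) tangent set"
  where "dirac_distribution L p = fst ` L p"


section \<open>The pre-symplectic foliation\<close>

text \<open>
  An immersed submanifold \<open>N\<close> of \<open>M\<close> has its underlying set in \<open>M\<close> but a topology and an atlas of
  its own; \<open>incl_tangent N M p\<close> is the tangent map at \<open>p\<close> of the inclusion.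
\<close>

definition smooth_inclusion ::
  "('a, 'e::euclidean_space) manifold \<Rightarrow> ('a, 'e) manifold \<Rightarrow> bool"
  where "smooth_inclusion N M \<longleftrightarrow>
    continuous_map (mtop N) (mtop M) (\<lambda>p. p) \<and>
    (\<forall>c\<in>matlas N. \<forall>d\<in>matlas M.
       smooth_on (mmodel N) (snd c ` (fst c \<inter> fst d)) (snd d \<circ> chart_inv c))"

definition incl_tangent ::
  "('a, 'e::euclidean_space) manifold \<Rightarrow> ('a, 'e) manifold \<Rightarrow> 'a
    \<Rightarrow> ('a, 'e) tangent \<Rightarrow> ('a, 'e) tangent"
  where "incl_tangent N M p v =
    (let c = some_chart N p
     in (\<lambda>d. if d \<in> charts_at M p then chart_deriv c (snd d) p (v c) else 0))"

definition immersed_submanifold ::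
  "('a, 'e::euclidean_space) manifold \<Rightarrow> ('a, 'e) manifold \<Rightarrow> bool"
  where "immersed_submanifold N M \<longleftrightarrow>
    smooth_manifold N \<and> smooth_inclusion N M \<and>
    (\<forall>p\<in>topspace (mtop N). inj_on (incl_tangent N M p) (tangent_space N p))"

definition integral_manifold ::
  "('a, 'e::euclidean_space) manifold \<Rightarrow> ('a \<Rightarrow> ('a, 'e) tangent set)
    \<Rightarrow> ('a, 'e) manifold \<Rightarrow> bool"
  where "integral_manifold M D N \<longleftrightarrow>
    immersed_submanifold N M \<and>
    topspace (mtop N) \<noteq> {} \<and> connected_space (mtop N) \<and>
    (\<forall>p\<in>topspace (mtop N). incl_tangent N M p ` tangent_space N p = D p)"

text \<open>The leaves of the foliation to which \<open>D\<close> integrates are its maximal connected integral manifolds.\<close>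

definition leaf ::
  "('a, 'e::euclidean_space) manifold \<Rightarrow> ('a \<Rightarrow> ('a, 'e) tangent set)
    \<Rightarrow> ('a, 'e) manifold \<Rightarrow> bool"
  where "leaf M D N \<longleftrightarrow>
    integral_manifold M D N \<and>
    (\<forall>N'. integral_manifold M D N' \<and> topspace (mtop N) \<subseteq> topspace (mtop N')
        \<longrightarrow> topspace (mtop N') = topspace (mtop N))"

definition presymplectic_foliation ::
  "('a, 'e::euclidean_space) manifold \<Rightarrow> ('a \<Rightarrow> ('a, 'e) gen_tangent set)
    \<Rightarrow> ('a, 'e) manifold set"
  where "presymplectic_foliation M L = {N. leaf M (dirac_distribution L) N}"

end

theory Submission
  imports Defs
begin

text \<open>
  Near a point \<open>p\<close>, in a chart, choose a complement \<open>E\<close> of \<open>D\<^sub>p\<close>. Then \<open>E \<oplus> Ann E\<close> is transversal to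
  \<open>L\<^sub>p\<close>, hence to \<open>L\<^sub>q\<close> for \<open>q\<close> near \<open>p\<close>, because \<open>L\<close> has a continuous frame. Since \<open>L\<^sub>q\<close> is maximal
  isotropic, transversality gives \<open>D\<^sub>q + E = T\<^sub>qM\<close>, so \<open>dim D\<^sub>q = dim D\<^sub>p + dim (D\<^sub>q \<inter> E)\<close>, and makes the
  presymplectic form of \<open>L\<^sub>q\<close> nondegenerate on \<open>D\<^sub>q \<inter> E\<close>, whose dimension is therefore even. So the
  parity of \<open>dim D\<close> is locally constant, and \<open>M\<close> is connected.
\<close>

section \<open>Linear algebra\<close>

text \<open>The obstacle is that the dimension of \<open>D\<close> jumps, so the presymplectic forms
  at nearby points live on spaces that cannot be compared directly. What varies continuously is
  \<open>L\<close>; everything is read off from its position relative to one test space that stays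
  fixed in the chart. Transversality at \<open>p\<close> holds because an element (x, a) of both
  spaces has x in D \<inter> E = 0; isotropy then makes a vanish on D, and a vanishes on E as well.
  It is an open condition, since it says that a linear map with kernel E \<oplus> Ann E is injective
  on the span of the frame. At \<open>q\<close> maximality enters as Ann D \<subseteq> L. A covector
  that annihilates D + E lies in both spaces, hence is 0. Since Ann (D \<inter> E) = Ann D + Ann E,
  an element of the radical of the form on D \<inter> E has a covector that can be corrected by Ann
  D to one in Ann E, so it is 0 too. Taking E orthogonal to D at \<open>p\<close>, and covectors as
  vectors, turns Ann E into D at \<open>p\<close> itself.\<close>

lemma orthonormal_expansion:
  fixes F :: "'e::euclidean_space set"
  assumes "subspace F"
  obtains B where "finite B" "B \<subseteq> F" "\<And>x. x \<in> F \<Longrightarrow> (\<Sum>b\<in>B. (x \<bullet> b) *\<^sub>R b) = x"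
proof -
  obtain B where B: "B \<subseteq> F" "pairwise orthogonal B" "\<And>x. x \<in> B \<Longrightarrow> norm x = 1"
      "independent B" "card B = dim F" "span B = F"
    using orthonormal_basis_subspace[OF assms] by metis
  have fin: "finite B"
    using B(4) independent_imp_finite by blast
  have "(\<Sum>b\<in>B. (x \<bullet> b) *\<^sub>R b) = x" if "x \<in> F" for x
  proof (rule vector_eq_dot_span[where B = B])
    fix b assume b: "b \<in> B"
    have "(\<Sum>c\<in>B. (x \<bullet> c) *\<^sub>R c) \<bullet> b = (\<Sum>c\<in>B. if c = b then x \<bullet> b else 0)"
      unfolding inner_sum_left
      using B(2,3) b by (intro sum.cong) (auto simp: pairwise_def orthogonal_def dot_square_norm)
    then show "b \<bullet> (\<Sum>c\<in>B. (x \<bullet> c) *\<^sub>R c) = b \<bullet> x"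
      using fin b by (simp add: inner_commute)
  next
    show "(\<Sum>b\<in>B. (x \<bullet> b) *\<^sub>R b) \<in> span B"
      by (intro span_sum span_scale span_base)
  qed (use that B(6) in auto)
  then show ?thesis
    using that fin B(1) by blast
qed

text \<open>Serves two purposes: \<open>\<pi>\<close> turns membership in a subspace into an
  equation that can be differentiated, and it lets the test space E \<oplus> Ann E be cut out by
  linear equations.\<close>

lemma orthogonal_projection_exists:
  fixes W :: "'e::euclidean_space set"
  assumes "subspace W"
  obtains \<pi> where "linear \<pi>" "range \<pi> \<subseteq> W" "\<And>x. x \<in> W \<Longrightarrow> \<pi> x = x"
    "\<And>x. (\<And>w. w \<in> W \<Longrightarrow> x \<bullet> w = 0) \<Longrightarrow> \<pi> x = 0"
proof -
  obtain B where B: "finite B" "B \<subseteq> W" "\<And>x. x \<in> W \<Longrightarrow> (\<Sum>b\<in>B. (x \<bullet> b) *\<^sub>R b) = x"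
    using orthonormal_expansion[OF assms] by blast
  show ?thesis
  proof
    show "linear (\<lambda>x. \<Sum>b\<in>B. (x \<bullet> b) *\<^sub>R b)"
      by (intro linearI)
        (simp_all add: inner_left_distrib scaleR_add_left sum.distrib scaleR_sum_right)
    show "range (\<lambda>x. \<Sum>b\<in>B. (x \<bullet> b) *\<^sub>R b) \<subseteq> W"
      using assms B(2) by (auto intro!: subspace_sum subspace_scale)
    show "(\<Sum>b\<in>B. (x \<bullet> b) *\<^sub>R b) = 0" if "\<And>w. w \<in> W \<Longrightarrow> x \<bullet> w = 0" for x
      using that B(2) by (intro sum.neutral) auto
  qed (use B(3) in auto)
qed

text \<open>The double annihilator argument in usable form: if \<open>x\<close> is orthogonal to
  everything in \<open>F\<close> that is orthogonal to \<open>S\<close>, the last equation forces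
  \<open>z = 0\<close>, so \<open>x\<close> lies in \<open>S\<close>.\<close>

lemma orthogonal_decomposition:
  fixes S F :: "'e::euclidean_space set"
  assumes "subspace S" "subspace F" "S \<subseteq> F" "x \<in> F"
  obtains y z where "y \<in> S" "z \<in> F" "\<And>w. w \<in> S \<Longrightarrow> z \<bullet> w = 0" "x = y + z" "x \<bullet> z = z \<bullet> z"
proof -
  obtain y z where yz: "y \<in> span S" "\<And>w. w \<in> span S \<Longrightarrow> orthogonal z w" "x = y + z"
    using orthogonal_subspace_decomp_exists[of S x] by blast
  have "span S = S"
    using assms(1) by simp
  have z: "z = x - y"
    using yz(3) by simp
  show ?thesis
  proof
    show "y \<in> S"
      using yz(1) \<open>span S = S\<close> by simp
    then show "z \<in> F"
      unfolding z using assms by (blast intro: subspace_diff)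
    show "z \<bullet> w = 0" if "w \<in> S" for w
      using yz(2)[of w] that \<open>span S = S\<close> by (simp add: orthogonal_def)
    show "x \<bullet> z = z \<bullet> z"
      using yz(2)[OF yz(1)] yz(3) by (simp add: orthogonal_def inner_add inner_commute)
  qed (rule yz(3))
qed

lemma subset_sum_of_subspaces:
  assumes "subspace S" "subspace T"
  shows "S \<subseteq> {x + y |x y. x \<in> S \<and> y \<in> T}" and "T \<subseteq> {x + y |x y. x \<in> S \<and> y \<in> T}"
proof -
  show "S \<subseteq> {x + y |x y. x \<in> S \<and> y \<in> T}"
    using subspace_0[OF assms(2)] by (intro subsetI CollectI) (metis add.right_neutral)
  show "T \<subseteq> {x + y |x y. x \<in> S \<and> y \<in> T}"
    using subspace_0[OF assms(1)] by (intro subsetI CollectI) (metis add.left_neutral)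
qed

text \<open>Symplectic induction: two vectors with nonzero \<open>\<omega>\<close> span a
  nondegenerate plane, and its \<open>\<omega>\<close>-orthogonal complement in \<open>S\<close> is
  again nondegenerate, of dimension smaller by 2.\<close>

lemma even_dim_if_nondegenerate_alternating:
  fixes S :: "'e::euclidean_space set" and \<omega> :: "'e \<Rightarrow> 'e \<Rightarrow> real"
  assumes "bilinear \<omega>" and "subspace S"
    and "\<And>x. x \<in> S \<Longrightarrow> \<omega> x x = 0"
    and "\<And>x. x \<in> S \<Longrightarrow> (\<And>y. y \<in> S \<Longrightarrow> \<omega> x y = 0) \<Longrightarrow> x = 0"
  shows "even (dim S)"
  using assms(2-)
proof (induction "dim S" arbitrary: S rule: less_induct)
  case less
  note add = bilinear_ladd[OF assms(1)] bilinear_radd[OF assms(1)]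
    and mul = bilinear_lmul[OF assms(1)] bilinear_rmul[OF assms(1)]
    and sub = bilinear_lsub[OF assms(1)] bilinear_rsub[OF assms(1)]
  have skew: "\<omega> u v = - \<omega> v u" if "u \<in> S" "v \<in> S" for u v
    using less.prems(2)[of "u + v"] less.prems(2)[OF that(1)] less.prems(2)[OF that(2)]
      subspace_add[OF less.prems(1) that] by (simp add: add)
  show ?case
  proof (cases "S \<subseteq> {0}")
    case True
    then show ?thesis
      by (metis dim_eq_0 even_zero)
  next
    case False
    then obtain x y where xy: "x \<in> S" "y \<in> S" "\<omega> x y \<noteq> 0"
      using less.prems(3) by blast
    define y' where "y' = (1 / \<omega> x y) *\<^sub>R y"
    have y': "y' \<in> S" "\<omega> x y' = 1"
      using xy less.prems(1) by (auto simp: y'_def subspace_scale mul)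
    have vals: "\<omega> x x = 0" "\<omega> y' y' = 0" "\<omega> y' x = -1"
      using less.prems(2) xy(1) y' skew[OF y'(1) xy(1)] by auto
    define S' where "S' = {z \<in> S. \<omega> x z = 0 \<and> \<omega> y' z = 0}"
    \<comment> \<open>The projection of \<open>S\<close> onto \<open>S'\<close> along the plane. Its
      coefficients are forced by \<open>\<omega> x y' = 1\<close> and
      \<open>\<omega> y' x = -1\<close>.\<close>
    define p where "p z = z - \<omega> x z *\<^sub>R y' + \<omega> y' z *\<^sub>R x" for z
    have sS': "subspace S'"
      using less.prems(1) bilinear_rzero[OF assms(1)]
      by (auto simp: S'_def subspace_def add mul)
    have p: "p z \<in> S'" if "z \<in> S" for z
      using that xy(1) y'(1) less.prems(1)
      by (auto simp: S'_def p_def subspace_add subspace_diff subspace_scale add mul sub vals y'(2))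
    have S_eq: "S = {a + b |a b. a \<in> S' \<and> b \<in> span {x, y'}}"
    proof safe
      fix z assume "z \<in> S"
      then have "p z \<in> S'" by (rule p)
      moreover have "\<omega> x z *\<^sub>R y' - \<omega> y' z *\<^sub>R x \<in> span {x, y'}"
        by (intro span_diff span_scale span_base) auto
      moreover have "z = p z + (\<omega> x z *\<^sub>R y' - \<omega> y' z *\<^sub>R x)"
        by (simp add: p_def)
      ultimately show "\<exists>a b. z = a + b \<and> a \<in> S' \<and> b \<in> span {x, y'}"
        by blast
    next
      fix a b assume "a \<in> S'" "b \<in> span {x, y'}"
      moreover have "span {x, y'} \<subseteq> S"
        using less.prems(1) xy(1) y'(1) by (intro span_minimal) auto
      ultimately show "a + b \<in> S"
        using less.prems(1) by (auto simp: S'_def intro: subspace_add)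
    qed
    have int: "S' \<inter> span {x, y'} \<subseteq> {0}"
    proof
      fix z assume z: "z \<in> S' \<inter> span {x, y'}"
      then have "z \<in> span {x, y'}" by blast
      then obtain a where "z - a *\<^sub>R x \<in> span {y'}"
        by (auto simp: span_insert[of x])
      then obtain b where "z - a *\<^sub>R x = b *\<^sub>R y'"
        by (auto simp: span_singleton)
      then have ab: "z = a *\<^sub>R x + b *\<^sub>R y'"
        by (simp add: diff_eq_eq add.commute)
      have "\<omega> x z = 0" "\<omega> y' z = 0"
        using z by (auto simp: S'_def)
      then show "z \<in> {0}"
        using ab by (simp add: add mul vals y'(2))
    qed
    have ind: "independent {x, y'}" "x \<noteq> y'"
    proof -
      show "x \<noteq> y'" using y' vals by auto
      moreover have "x \<notin> span {y'}"
        using vals y'(2) mul by (auto simp: span_singleton)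
      moreover have "y' \<noteq> 0"
        using y'(2) bilinear_rzero[OF assms(1)] by auto
      ultimately show "independent {x, y'}"
        by (simp add: independent_insert)
    qed
    have "dim S + dim (S' \<inter> span {x, y'}) = dim S' + dim (span {x, y'})"
      using dim_sums_Int[OF sS' subspace_span, of "{x, y'}"] S_eq by simp
    moreover have "dim (S' \<inter> span {x, y'}) = 0"
      using int dim_eq_0 by blast
    moreover have "dim (span {x, y'}) = 2"
      using ind by (simp add: dim_eq_card_independent)
    ultimately have dim: "dim S = dim S' + 2"
      by simp
    moreover have "even (dim S')"
    proof (rule less.hyps)
      show "dim S' < dim S" using dim by simp
      show "\<omega> z z = 0" if "z \<in> S'" for z
        using that less.prems(2) by (auto simp: S'_def)
      fix z assume z: "z \<in> S'" "\<And>v. v \<in> S' \<Longrightarrow> \<omega> z v = 0"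
      show "z = 0"
      proof (rule less.prems(3))
        show zS: "z \<in> S" using z by (simp add: S'_def)
        \<comment> \<open>As \<open>z\<close> is \<open>\<omega>\<close>-orthogonal to the plane,
          \<open>v\<close> may be replaced by its projection \<open>p v\<close> in
          \<open>S'\<close>.\<close>
        fix v assume v: "v \<in> S"
        have "\<omega> z x = 0" "\<omega> z y' = 0"
          using z(1) skew[OF zS xy(1)] skew[OF zS y'(1)] by (auto simp: S'_def)
        then show "\<omega> z v = 0"
          using z(2)[OF p[OF v]] by (simp add: p_def add sub mul)
      qed
    qed (rule sS')
    ultimately show ?thesis by simp
  qed
qed

text \<open>Functionals dual to the limit family give a matrix that tends to the identity, so it is
  eventually diagonally dominant and has trivial kernel. The family may be smaller than a basis.
  Indexing the coefficients by \<open>I\<close> covers injectivity and independence at once.\<close>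

lemma eventually_independent_family:
  fixes y :: "'i \<Rightarrow> 'x \<Rightarrow> 'v::euclidean_space"
  assumes "finite I" and "inj_on y0 I" and "independent (y0 ` I)"
    and "\<And>i. i \<in> I \<Longrightarrow> (y i \<longlongrightarrow> y0 i) G"
  shows "\<forall>\<^sub>F q in G. \<forall>t. (\<Sum>i\<in>I. t i *\<^sub>R y i q) = 0 \<longrightarrow> (\<forall>i\<in>I. t i = (0::real))"
proof -
  have "\<exists>\<phi>::'v \<Rightarrow> real. linear \<phi> \<and> (\<forall>j\<in>I. \<phi> (y0 j) = (if j = i then 1 else 0))" for i
  proof -
    obtain \<phi> :: "'v \<Rightarrow> real" where \<phi>: "linear \<phi>"
        "\<forall>v\<in>y0 ` I. \<phi> v = (if the_inv_into I y0 v = i then 1 else 0)"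
      using linear_independent_extend[OF assms(3),
          of "\<lambda>v. if the_inv_into I y0 v = i then 1 else 0"] by blast
    have "\<phi> (y0 j) = (if j = i then 1 else 0)" if "j \<in> I" for j
      using \<phi>(2) the_inv_into_f_f[OF assms(2) that] that by simp
    then show ?thesis
      using \<phi>(1) by blast
  qed
  then obtain \<phi> :: "'i \<Rightarrow> 'v \<Rightarrow> real" where lin: "\<And>i. linear (\<phi> i)"
    and dual: "\<And>i j. j \<in> I \<Longrightarrow> \<phi> i (y0 j) = (if j = i then 1 else 0)"
    by metis
  \<comment> \<open>Chosen so that a whole row of errors sums to at most 1/2; the \<open>+ 1\<close>
    keeps the denominator nonzero.\<close>
  define \<epsilon> where "\<epsilon> = 1 / (2 * (real (card I) + 1))"
  have eps: "\<epsilon> > 0"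
    by (simp add: \<epsilon>_def)
  have "\<forall>\<^sub>F q in G. \<bar>\<phi> i (y j q) - \<phi> i (y0 j)\<bar> < \<epsilon>" if "j \<in> I" for i j
  proof -
    have "bounded_linear (\<phi> i)"
      using lin linear_conv_bounded_linear by blast
    then have "((\<lambda>q. \<phi> i (y j q)) \<longlongrightarrow> \<phi> i (y0 j)) G"
      using assms(4)[OF that] by (rule bounded_linear.tendsto)
    from tendstoD[OF this eps] show ?thesis
      by (simp add: dist_real_def)
  qed
  then have "\<forall>\<^sub>F q in G. \<forall>j\<in>I. \<bar>\<phi> i (y j q) - \<phi> i (y0 j)\<bar> < \<epsilon>" for i
    using eventually_ball_finite[OF assms(1), of "\<lambda>q j. \<bar>\<phi> i (y j q) - \<phi> i (y0 j)\<bar> < \<epsilon>" G]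
    by simp
  then have "\<forall>\<^sub>F q in G. \<forall>i\<in>I. \<forall>j\<in>I. \<bar>\<phi> i (y j q) - \<phi> i (y0 j)\<bar> < \<epsilon>"
    using eventually_ball_finite[OF assms(1),
        of "\<lambda>q i. \<forall>j\<in>I. \<bar>\<phi> i (y j q) - \<phi> i (y0 j)\<bar> < \<epsilon>" G]
    by simp
  then show ?thesis
  proof eventually_elim
    case (elim q)
    show ?case
    proof (intro allI impI)
      fix t :: "'i \<Rightarrow> real" assume t: "(\<Sum>i\<in>I. t i *\<^sub>R y i q) = 0"
      show "\<forall>i\<in>I. t i = 0"
      proof (cases "I = {}")
        case False
        \<comment> \<open>In the row of the largest coefficient the errors amount to at most half of
          it, whence m \<le> m/2.\<close>
        define m where "m = Max ((\<lambda>i. \<bar>t i\<bar>) ` I)"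
        have "m \<in> (\<lambda>i. \<bar>t i\<bar>) ` I"
          unfolding m_def using False assms(1) by (intro Max_in) auto
        then obtain i where i: "i \<in> I" "\<bar>t i\<bar> = m"
          by auto
        have le: "\<bar>t j\<bar> \<le> m" if "j \<in> I" for j
          unfolding m_def using that assms(1) by auto
        have "0 = \<phi> i (\<Sum>j\<in>I. t j *\<^sub>R y j q)"
          using t linear_0[OF lin] by simp
        also have "\<dots> = (\<Sum>j\<in>I. t j * \<phi> i (y j q))"
          by (simp add: linear_sum[OF lin] linear_scale[OF lin])
        also have "\<dots> = (\<Sum>j\<in>I. t j * \<phi> i (y0 j)) + (\<Sum>j\<in>I. t j * (\<phi> i (y j q) - \<phi> i (y0 j)))"
          by (simp add: sum.distrib[symmetric] algebra_simps)
        also have "(\<Sum>j\<in>I. t j * \<phi> i (y0 j)) = (\<Sum>j\<in>I. if j = i then t j else 0)"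
          by (intro sum.cong) (auto simp: dual)
        also have "\<dots> = t i"
          using assms(1) i by simp
        finally have "m = \<bar>\<Sum>j\<in>I. t j * (\<phi> i (y j q) - \<phi> i (y0 j))\<bar>"
          using i by linarith
        also have "\<dots> \<le> (\<Sum>j\<in>I. \<bar>t j * (\<phi> i (y j q) - \<phi> i (y0 j))\<bar>)"
          by (rule sum_abs)
        also have "\<dots> \<le> (\<Sum>j\<in>I. m * \<epsilon>)"
          unfolding abs_mult using elim i le
          by (intro sum_mono mult_mono) (auto simp: less_imp_le intro: order_trans[OF abs_ge_zero])
        also have "\<dots> = m * (card I * \<epsilon>)"
          by simp
        also have "\<dots> \<le> m * (1/2)"
          using i by (intro mult_left_mono) (auto simp: \<epsilon>_def field_simps)
        finally have "m \<le> 0"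
          by simp
        then show ?thesis
          using le by force
      qed auto
    qed
  qed
qed

text \<open>
  A pair \<open>(x, a)\<close> stands for the vector \<open>x\<close> and the covector \<open>(\<bullet>) a\<close> of \<open>F\<close>. With \<open>E = F \<inter> W\<^sup>\<bottom>\<close>,
  the last assumption says that \<open>\<Lambda>\<close> is transversal to \<open>E \<oplus> Ann E\<close>.
\<close>

lemma lagrangian_projection_parity:
  fixes F W :: "'e::euclidean_space set" and \<Lambda> :: "('e \<times> 'e) set"
  assumes F: "subspace F" and W: "subspace W" "W \<subseteq> F"
    and \<Lambda>: "subspace \<Lambda>" "\<Lambda> \<subseteq> F \<times> F"
    and iso: "\<And>x a y b. (x, a) \<in> \<Lambda> \<Longrightarrow> (y, b) \<in> \<Lambda> \<Longrightarrow> a \<bullet> y + b \<bullet> x = 0"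
    and max: "\<And>b. b \<in> F \<Longrightarrow> (\<And>y. y \<in> fst ` \<Lambda> \<Longrightarrow> b \<bullet> y = 0) \<Longrightarrow> (0, b) \<in> \<Lambda>"
    and transversal: "\<And>x a. (x, a) \<in> \<Lambda> \<Longrightarrow> (\<And>w. w \<in> W \<Longrightarrow> x \<bullet> w = 0) \<Longrightarrow> a \<in> W \<Longrightarrow> x = 0 \<and> a = 0"
  shows "even (dim (fst ` \<Lambda>)) \<longleftrightarrow> even (dim W)"
proof -
  define D where "D = fst ` \<Lambda>"
  define E where "E = {x \<in> F. \<forall>w\<in>W. x \<bullet> w = 0}"
  define S where "S = D \<inter> E"
  have D: "subspace D" "D \<subseteq> F"
    using \<Lambda> linear_subspace_image[OF linear_fst \<Lambda>(1)] by (auto simp: D_def)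
  have E: "subspace E"
    using F by (auto simp: E_def subspace_def inner_left_distrib)
  have S: "subspace S"
    unfolding S_def using D(1) E by (rule subspace_inter)
  have perp_E: "x \<in> W" if x: "x \<in> F" "\<And>e. e \<in> E \<Longrightarrow> x \<bullet> e = 0" for x
  proof -
    obtain w v where wv: "w \<in> W" "v \<in> F" "\<And>u. u \<in> W \<Longrightarrow> v \<bullet> u = 0" "x = w + v"
        "x \<bullet> v = v \<bullet> v"
      using orthogonal_decomposition[OF W(1) F W(2) x(1)] by blast
    then have "v = 0"
      using x(2)[of v] by (simp add: E_def)
    then show ?thesis
      using wv by simp
  qed
  have perp_D: "(0, b) \<in> \<Lambda>" if "b \<in> F" "\<And>y. y \<in> D \<Longrightarrow> b \<bullet> y = 0" for b
    using that max unfolding D_def by blast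
  define V where "V = {x + y |x y. x \<in> D \<and> y \<in> E}"
  have V: "subspace V" "D \<subseteq> V" "E \<subseteq> V" "V \<subseteq> F"
    using subspace_sums[OF D(1) E] subset_sum_of_subspaces[OF D(1) E] D(2) F
    by (auto simp: V_def E_def intro: subspace_add)
  \<comment> \<open>The part \<open>v\<close> of a vector orthogonal to D + E is a covector in Ann
    D, hence over 0 in \<open>\<Lambda>\<close>, and in Ann E = \<open>W\<close>; transversality
    kills it.\<close>
  have "F \<subseteq> V"
  proof
    fix x assume x: "x \<in> F"
    obtain u v where uv: "u \<in> V" "v \<in> F" "\<And>w. w \<in> V \<Longrightarrow> v \<bullet> w = 0" "x = u + v"
      using orthogonal_decomposition[OF V(1) F V(4) x] by blast
    have "v \<in> W"
      using uv(2,3) V(3) by (intro perp_E) auto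
    moreover have "(0, v) \<in> \<Lambda>"
      using uv(2,3) V(2) by (intro perp_D) auto
    ultimately have "v = 0"
      using transversal[of 0 v] by simp
    then show "x \<in> V"
      using uv by simp
  qed
  with V(4) have "V = F"
    by blast
  have "dim E + dim W = dim F"
    using dim_subspace_orthogonal_to_vectors[OF W(1) F W(2)]
    by (simp add: E_def orthogonal_def inner_commute)
  moreover have "dim F + dim S = dim D + dim E"
    using dim_sums_Int[OF D(1) E] \<open>V = F\<close> by (simp add: S_def V_def)
  ultimately have dim: "dim D = dim W + dim S"
    by simp
  \<comment> \<open>A linear choice of a covector \<open>J x\<close> over each \<open>x\<close> in
    \<open>D\<close>; \<open>J x \<bullet> y\<close> is then the presymplectic form of
    \<open>\<Lambda>\<close>. Two choices differ by a covector over 0, which vanishes on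
    \<open>D\<close> by isotropy.\<close>
  obtain g where g: "range g \<subseteq> \<Lambda>" "linear g" "\<forall>v\<in>D. fst (g v) = v"
    using linear_exists_right_inverse_on[OF linear_fst \<Lambda>(1)] unfolding D_def by blast
  define J where "J x = snd (g x)" for x
  have J: "(x, J x) \<in> \<Lambda>" if "x \<in> D" for x
    using g that by (metis J_def prod.collapse rangeI subsetD)
  have linJ: "linear J"
    unfolding J_def using linear_compose[OF g(2) linear_snd] by (simp add: o_def)
  have "even (dim S)"
  proof (rule even_dim_if_nondegenerate_alternating[of "\<lambda>x y. J x \<bullet> y"])
    show "bilinear (\<lambda>x y. J x \<bullet> y)"
      unfolding bilinear_def
      by (auto intro!: linearI simp: linear_add[OF linJ] linear_scale[OF linJ] inner_add)
    show "J x \<bullet> x = 0" if "x \<in> S" for x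
      using that iso[OF J J, of x x] by (auto simp: S_def)
    fix x assume x: "x \<in> S" and deg: "\<And>y. y \<in> S \<Longrightarrow> J x \<bullet> y = 0"
    have xJ: "(x, J x) \<in> \<Lambda>" "J x \<in> F"
      using x J \<Lambda>(2) by (auto simp: S_def)
    define D' where "D' = {b \<in> F. \<forall>y\<in>D. b \<bullet> y = 0}"
    have D': "subspace D'"
      using F by (auto simp: D'_def subspace_def inner_left_distrib)
    \<comment> \<open>\<open>U\<close> is Ann E + Ann D, and the aim is that \<open>J x\<close>,
      which annihilates D \<inter> E, lies in it. The part \<open>v\<close> of \<open>J x\<close>
      orthogonal to \<open>U\<close> is orthogonal to both annihilators, so it lies in D \<inter> E,
      where \<open>J x\<close> vanishes.\<close>
    define U where "U = {k + b |k b. k \<in> W \<and> b \<in> D'}"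
    have U: "subspace U"
      unfolding U_def using W(1) D' by (rule subspace_sums)
    have sub_U: "W \<subseteq> U" "D' \<subseteq> U"
      unfolding U_def using W(1) D' by (rule subset_sum_of_subspaces)+
    have "U \<subseteq> F"
      using W(2) F by (auto simp: U_def D'_def intro: subspace_add)
    obtain u v where uv: "u \<in> U" "v \<in> F" "\<And>w. w \<in> U \<Longrightarrow> v \<bullet> w = 0" "J x = u + v"
        "J x \<bullet> v = v \<bullet> v"
      using orthogonal_decomposition[OF U F \<open>U \<subseteq> F\<close> xJ(2)] by blast
    have vD: "v \<in> D"
    proof -
      obtain d e where de: "d \<in> D" "e \<in> F" "\<And>w. w \<in> D \<Longrightarrow> e \<bullet> w = 0" "v = d + e"
          "v \<bullet> e = e \<bullet> e"
        using orthogonal_decomposition[OF D(1) F D(2) uv(2)] by blast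
      then have "e \<in> D'"
        by (simp add: D'_def)
      then have "e = 0"
        using uv(3)[of e] de(5) sub_U(2) by auto
      then show ?thesis
        using de by simp
    qed
    have "v \<in> S"
      using vD uv(2,3) sub_U(1) by (auto simp: S_def E_def)
    then have "v = 0"
      using deg[of v] uv(5) by simp
    then obtain k b where kb: "k \<in> W" "b \<in> D'" "J x = k + b"
      using uv(1,4) by (auto simp: U_def)
    \<comment> \<open>Subtracting the Ann D part keeps the pair in \<open>\<Lambda>\<close> and
      leaves \<open>x\<close> in E with a covector in Ann E.\<close>
    have "(0, b) \<in> \<Lambda>"
      using kb(2) perp_D by (auto simp: D'_def)
    then have "(x, k) \<in> \<Lambda>"
      using subspace_diff[OF \<Lambda>(1) xJ(1)] kb(3) by fastforce
    then show "x = 0"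
      using transversal[of x k] kb(1) x by (auto simp: S_def E_def)
  qed (rule S)
  then show ?thesis
    using dim by (simp add: D_def)
qed


section \<open>Derivatives in charts\<close>

text \<open>Brings derivatives taken within different chart images and overlaps to the common filter
  within the model space, where they can be compared.\<close>

lemma at_within_openin:
  assumes "openin (top_of_set F) U" "x \<in> U"
  shows "at x within U = at x within F"
proof -
  obtain T where "open T" "U = F \<inter> T"
    using assms(1) openin_open by blast
  then show ?thesis
    using assms(2) by (intro at_within_nhd[of x T]) auto
qed

text \<open>
  Derivatives within a proper subspace are not unique as linear maps on the ambient space, but
  they are in the directions of the subspace.
\<close>

lemma has_derivative_within_subspace_unique:
  fixes f :: "'e::real_normed_vector \<Rightarrow> 'b::real_normed_vector"
  assumes "(f has_derivative A) (at x within F)" "(f has_derivative B) (at x within F)"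
    and "subspace F" "x \<in> F" "e \<in> F"
  shows "A e = B e"
proof -
  \<comment> \<open>Along the line through \<open>x\<close> in direction \<open>e\<close> the
    function depends on one real variable, where derivatives are unique.\<close>
  define g where "g t = x + t *\<^sub>R e" for t :: real
  have g: "(g has_derivative (\<lambda>t. t *\<^sub>R e)) (at 0 within UNIV)"
    unfolding g_def by (auto intro!: derivative_eq_intros)
  have "g ` UNIV \<subseteq> F"
    using assms(3-5) by (auto simp: g_def intro: subspace_add subspace_scale)
  then have "(f \<circ> g has_derivative D \<circ> (\<lambda>t. t *\<^sub>R e)) (at 0 within UNIV)"
    if "(f has_derivative D) (at x within F)" for D
    using g that by (intro diff_chain_within) (auto simp: g_def intro: has_derivative_subset)
  then have "A \<circ> (\<lambda>t. t *\<^sub>R e) = B \<circ> (\<lambda>t. t *\<^sub>R e)"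
    using assms(1,2) by (intro has_derivative_unique[of "f \<circ> g" _ 0]) auto
  from fun_cong[OF this, of 1] show ?thesis
    by simp
qed

text \<open>With \<open>\<pi>\<close> a projection onto \<open>G\<close>,
  \<open>\<pi> \<circ> f\<close> agrees with \<open>f\<close> on \<open>U\<close>, so
  \<open>\<pi> \<circ> A\<close> is a derivative of \<open>f\<close> as well, and uniqueness gives
  \<open>A e = \<pi> (A e)\<close>.\<close>

lemma has_derivative_within_subspace_mem:
  fixes f :: "'e::real_normed_vector \<Rightarrow> 'b::euclidean_space"
  assumes "(f has_derivative A) (at x within F)" and "openin (top_of_set F) U" "x \<in> U"
    and "f ` U \<subseteq> G" "subspace F" "subspace G" "e \<in> F"
  shows "A e \<in> G"
proof -
  obtain \<pi> where \<pi>: "linear \<pi>" "range \<pi> \<subseteq> G" "\<And>x. x \<in> G \<Longrightarrow> \<pi> x = x"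
    using orthogonal_projection_exists[OF assms(6)] by metis
  have U: "at x within U = at x within F" "x \<in> F"
    using at_within_openin[OF assms(2,3)] assms(2,3) openin_imp_subset by blast+
  have "bounded_linear \<pi>"
    using \<pi>(1) linear_conv_bounded_linear by blast
  from bounded_linear.has_derivative[OF this, of f A]
  have "((\<lambda>y. \<pi> (f y)) has_derivative (\<lambda>h. \<pi> (A h))) (at x within U)"
    using assms(1) U(1) by simp
  then have "(f has_derivative (\<lambda>h. \<pi> (A h))) (at x within U)"
    using assms(3,4) \<pi>(3) by (elim has_derivative_transform[rotated 2]) auto
  then have "(f has_derivative (\<lambda>h. \<pi> (A h))) (at x within F)"
    unfolding U(1) .
  from has_derivative_within_subspace_unique[OF assms(1) this assms(5) U(2) assms(7)]
  have "A e = \<pi> (A e)" .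
  then show ?thesis
    using \<pi>(2) by (metis rangeI subsetD)
qed

section \<open>Charts as homeomorphisms onto open subsets of the model space\<close>

lemma is_chart_inj: "is_chart T F c \<Longrightarrow> inj_on (snd c) (fst c)"
  using homeomorphic_imp_injective_map[of "subtopology T (fst c)" "top_of_set (snd c ` fst c)" "snd c"]
    openin_subset[of T "fst c"]
  by (simp add: is_chart_def topspace_subtopology Int_absorb1)

lemma chart_inv_coord: "is_chart T F c \<Longrightarrow> p \<in> fst c \<Longrightarrow> chart_inv c (snd c p) = p"
  unfolding chart_inv_def by (rule inv_into_f_f[OF is_chart_inj])

lemma is_chart_image_subset: "is_chart T F c \<Longrightarrow> snd c ` fst c \<subseteq> F"
  unfolding is_chart_def by (blast dest: openin_imp_subset)

lemma is_chart_openin_image: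
  assumes "is_chart T F c" "openin T V" "V \<subseteq> fst c"
  shows "openin (top_of_set F) (snd c ` V)"
proof -
  have "openin (subtopology T (fst c)) V"
    using assms(2,3) by (metis inf.absorb1 openin_subtopology_Int)
  then have "openin (top_of_set (snd c ` fst c)) (snd c ` V)"
    using assms homeomorphic_map_openness[of "subtopology T (fst c)" "top_of_set (snd c ` fst c)" "snd c" V]
      openin_subset[OF assms(2)]
    by (auto simp: is_chart_def topspace_subtopology)
  then show ?thesis
    using assms(1) openin_trans by (auto simp: is_chart_def)
qed

text \<open>\<open>chart_deriv\<close> differentiates within the whole chart image, whereas
  smoothness of transitions and inclusions is known only on overlaps; \<open>V\<close> is the
  overlap.\<close>

lemma chart_deriv_has_derivative:
  assumes "is_chart T F c" "openin T V" "V \<subseteq> fst c" "p \<in> V"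
    and "(f \<circ> chart_inv c) differentiable (at (snd c p) within snd c ` V)"
  shows "(f \<circ> chart_inv c has_derivative chart_deriv c f p) (at (snd c p) within F)"
proof -
  have "at (snd c p) within snd c ` V = at (snd c p) within F"
    using is_chart_openin_image[OF assms(1-3)] assms(4) by (intro at_within_openin) auto
  moreover have "at (snd c p) within snd c ` fst c = at (snd c p) within F"
    using assms(1,3,4) by (intro at_within_openin) (auto simp: is_chart_def)
  ultimately show ?thesis
    using assms(5) frechet_derivative_works by (metis chart_deriv_def[abs_def])
qed

lemma smooth_on_differentiable: "smooth_on F U f \<Longrightarrow> x \<in> U \<Longrightarrow> f differentiable (at x within U)"
  unfolding smooth_on_def using C_k_on.simps(2)[of 0] by blast

lemma smooth_on_continuous_on: "smooth_on F U f \<Longrightarrow> continuous_on U f"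
  unfolding smooth_on_def using C_k_on.simps(1) by blast

lemma smooth_manifold_is_chart:
  "smooth_manifold M \<Longrightarrow> c \<in> charts_at M p \<Longrightarrow> is_chart (mtop M) (mmodel M) c"
  by (simp add: smooth_manifold_def charts_at_def)

lemma smooth_manifold_subspace: "smooth_manifold M \<Longrightarrow> subspace (mmodel M)"
  by (simp add: smooth_manifold_def)

lemma charts_at_mem: "c \<in> charts_at M p \<Longrightarrow> p \<in> fst c"
  by (simp add: charts_at_def)

lemma coord_mem_model:
  assumes "smooth_manifold M" "c \<in> charts_at M p" "q \<in> fst c"
  shows "snd c q \<in> mmodel M"
  using is_chart_image_subset[OF smooth_manifold_is_chart[OF assms(1,2)]] assms(3) by auto

lemma some_chart_in_charts_at:
  assumes "smooth_manifold M" "p \<in> topspace (mtop M)"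
  shows "some_chart M p \<in> charts_at M p"
proof -
  have "\<exists>c. c \<in> charts_at M p"
    using assms unfolding smooth_manifold_def charts_at_def by blast
  then show ?thesis
    unfolding some_chart_def by (rule someI_ex)
qed

section \<open>Coordinate changes and their derivatives\<close>

context
  fixes M :: "('a, 'e::euclidean_space) manifold" and p :: 'a
  assumes M: "smooth_manifold M"
begin

lemma transition_has_derivative:
  assumes "c \<in> charts_at M p" "d \<in> charts_at M p"
  shows "(snd d \<circ> chart_inv c has_derivative chart_deriv c (snd d) p)
    (at (snd c p) within mmodel M)"
proof (rule chart_deriv_has_derivative)
  show c: "is_chart (mtop M) (mmodel M) c"
    using smooth_manifold_is_chart[OF M assms(1)] .
  have "is_chart (mtop M) (mmodel M) d"
    using smooth_manifold_is_chart[OF M assms(2)] .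
  with c show "openin (mtop M) (fst c \<inter> fst d)"
    by (auto simp: is_chart_def)
  show p: "p \<in> fst c \<inter> fst d"
    using assms by (simp add: charts_at_def)
  have "smooth_on (mmodel M) (snd c ` (fst c \<inter> fst d)) (snd d \<circ> chart_inv c)"
    using M assms by (auto simp: smooth_manifold_def charts_at_def)
  then show "(snd d \<circ> chart_inv c) differentiable (at (snd c p) within snd c ` (fst c \<inter> fst d))"
    using p by (intro smooth_on_differentiable) auto
qed auto

lemma linear_transition:
  "c \<in> charts_at M p \<Longrightarrow> d \<in> charts_at M p \<Longrightarrow> linear (chart_deriv c (snd d) p)"
  using has_derivative_linear[OF transition_has_derivative] .

lemma transition_overlap:
  assumes "c \<in> charts_at M p" "d \<in> charts_at M p"
  shows "openin (top_of_set (mmodel M)) (snd c ` (fst c \<inter> fst d))"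
    and "snd c p \<in> snd c ` (fst c \<inter> fst d)"
    and "(snd d \<circ> chart_inv c) ` snd c ` (fst c \<inter> fst d) \<subseteq> mmodel M"
proof -
  note ch = smooth_manifold_is_chart[OF M assms(1)] smooth_manifold_is_chart[OF M assms(2)]
  show "openin (top_of_set (mmodel M)) (snd c ` (fst c \<inter> fst d))"
    using ch by (intro is_chart_openin_image[OF ch(1)]) (auto simp: is_chart_def)
  show "snd c p \<in> snd c ` (fst c \<inter> fst d)"
    using assms by (simp add: charts_at_def)
  show "(snd d \<circ> chart_inv c) ` snd c ` (fst c \<inter> fst d) \<subseteq> mmodel M"
    using chart_inv_coord[OF ch(1)] is_chart_image_subset[OF ch(2)] by auto
qed

lemma transition_mem_model:
  assumes "c \<in> charts_at M p" "d \<in> charts_at M p" "e \<in> mmodel M"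
  shows "chart_deriv c (snd d) p e \<in> mmodel M"
  using assms smooth_manifold_subspace[OF M]
  by (intro has_derivative_within_subspace_mem[OF transition_has_derivative transition_overlap])

lemma transition_self:
  assumes "c \<in> charts_at M p" "e \<in> mmodel M"
  shows "chart_deriv c (snd c) p e = e"
proof -
  note ch = smooth_manifold_is_chart[OF M assms(1)]
  have eq: "at (snd c p) within snd c ` fst c = at (snd c p) within mmodel M"
    using at_within_openin transition_overlap[OF assms(1,1)] by auto
  have "(snd c \<circ> chart_inv c has_derivative (\<lambda>h. h)) (at (snd c p) within snd c ` fst c)"
    by (rule has_derivative_transform[OF _ _ has_derivative_ident])
      (use assms(1) in \<open>auto simp: charts_at_def chart_inv_coord[OF ch]\<close>)
  then show ?thesis
    using has_derivative_within_subspace_unique[OF transition_has_derivative[OF assms(1,1)]]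
      smooth_manifold_subspace[OF M] coord_mem_model[OF M assms(1) charts_at_mem[OF assms(1)]]
      assms(2) eq by auto
qed

lemma transition_cocycle:
  assumes "c \<in> charts_at M p" "d \<in> charts_at M p" "d' \<in> charts_at M p" "e \<in> mmodel M"
  shows "chart_deriv d (snd d') p (chart_deriv c (snd d) p e) = chart_deriv c (snd d') p e"
proof -
  note ch = smooth_manifold_is_chart[OF M assms(1)] smooth_manifold_is_chart[OF M assms(2)]
  define f where "f = snd d \<circ> chart_inv c"
  define g where "g = snd d' \<circ> chart_inv d"
  let ?U = "snd c ` (fst c \<inter> fst d)" and ?x = "snd c p"
  have U: "at ?x within ?U = at ?x within mmodel M"
    using transition_overlap[OF assms(1,2)] by (intro at_within_openin)
  have fx: "f ?x = snd d p"
    using chart_inv_coord[OF ch(1)] charts_at_mem[OF assms(1)] by (simp add: f_def)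
  have "(f has_derivative chart_deriv c (snd d) p) (at ?x within ?U)"
    using transition_has_derivative[OF assms(1,2)] U by (simp add: f_def)
  moreover have "(g has_derivative chart_deriv d (snd d') p) (at (f ?x) within f ` ?U)"
    unfolding fx using transition_has_derivative[OF assms(2,3)] transition_overlap(3)[OF assms(1,2)]
    by (auto simp: f_def g_def intro: has_derivative_subset)
  ultimately have "(g \<circ> f has_derivative chart_deriv d (snd d') p \<circ> chart_deriv c (snd d) p)
      (at ?x within ?U)"
    by (rule diff_chain_within)
  \<comment> \<open>The composite and the direct transition agree on the whole overlap of
    \<open>c\<close> and \<open>d\<close>, also outside the domain of \<open>d'\<close>, because
    both apply \<open>snd d'\<close> to the same point. Hence the triple overlap never
    appears.\<close>
  then have "(snd d' \<circ> chart_inv c has_derivative chart_deriv d (snd d') p \<circ> chart_deriv c (snd d) p)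
      (at ?x within ?U)"
    using transition_overlap(2)[OF assms(1,2)]
    by (elim has_derivative_transform[rotated 2])
      (auto simp: f_def g_def chart_inv_coord[OF ch(1)] chart_inv_coord[OF ch(2)])
  then show ?thesis
    using has_derivative_within_subspace_unique[OF transition_has_derivative[OF assms(1,3)]]
      smooth_manifold_subspace[OF M] coord_mem_model[OF M assms(1) charts_at_mem[OF assms(1)]]
      assms(4) U by (metis comp_apply)
qed


section \<open>Coordinates on tangent and cotangent spaces\<close>

lemma tangent_space_iff:
  "v \<in> tangent_space M p \<longleftrightarrow>
    (\<forall>c\<in>charts_at M p. v c \<in> mmodel M) \<and>
    (\<forall>c\<in>charts_at M p. \<forall>d\<in>charts_at M p. chart_deriv c (snd d) p (v c) = v d) \<and>
    (\<forall>c. c \<notin> charts_at M p \<longrightarrow> v c = 0)"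
  unfolding tangent_space_def mem_Collect_eq by (simp only: eq_commute)

lemma subspace_tangent_space: "subspace (tangent_space M p)"
proof (rule subspaceI)
  note F = smooth_manifold_subspace[OF M]
  show "0 \<in> tangent_space M p"
    by (simp add: tangent_space_iff subspace_0[OF F] linear_0[OF linear_transition])
  show "v + w \<in> tangent_space M p" if "v \<in> tangent_space M p" "w \<in> tangent_space M p" for v w
    using that by (simp add: tangent_space_iff subspace_add[OF F] linear_add[OF linear_transition])
  show "r *\<^sub>R v \<in> tangent_space M p" if "v \<in> tangent_space M p" for r v
    using that
    by (simp add: tangent_space_iff scaleR_fun_def subspace_scale[OF F] linear_scale[OF linear_transition])
qed

lemma coord_vec_mem_tangent_space:
  assumes "c \<in> charts_at M p" "e \<in> mmodel M"
  shows "coord_vec M c p e \<in> tangent_space M p"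
  using assms by (auto simp: tangent_space_def coord_vec_def transition_mem_model transition_cocycle)

lemma coord_vec_coord:
  "c \<in> charts_at M p \<Longrightarrow> e \<in> mmodel M \<Longrightarrow> coord_vec M c p e c = e"
  by (simp add: coord_vec_def transition_self)

lemma coord_vec_of_tangent:
  assumes "c \<in> charts_at M p" "v \<in> tangent_space M p"
  shows "coord_vec M c p (v c) = v"
proof
  fix d
  have "chart_deriv c (snd d) p (v c) = v d" if "d \<in> charts_at M p"
    using assms that unfolding tangent_space_iff by blast
  moreover have "v d = 0" if "d \<notin> charts_at M p"
    using assms that unfolding tangent_space_iff by blast
  ultimately show "coord_vec M c p (v c) d = v d"
    by (simp add: coord_vec_def)
qed

lemma tangent_coord_mem: "c \<in> charts_at M p \<Longrightarrow> v \<in> tangent_space M p \<Longrightarrow> v c \<in> mmodel M"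
  by (simp add: tangent_space_iff)

lemma linear_coord_vec:
  assumes "c \<in> charts_at M p"
  shows "linear (coord_vec M c p)"
  by (intro linearI ext) (simp_all add: coord_vec_def scaleR_fun_def
      linear_add[OF linear_transition[OF assms]] linear_scale[OF linear_transition[OF assms]])

end

lemma linear_eval: "linear (\<lambda>v. v c)"
  by (intro linearI) (simp_all add: scaleR_fun_def)

lemma subspace_cotangent_space: "subspace (cotangent_space M p)"
proof (rule subspaceI)
  show "0 \<in> cotangent_space M p"
    by (simp add: cotangent_space_def)
  show "\<alpha> + \<beta> \<in> cotangent_space M p"
    if "\<alpha> \<in> cotangent_space M p" "\<beta> \<in> cotangent_space M p" for \<alpha> \<beta>
    using that by (simp add: cotangent_space_def distrib_left)
  show "r *\<^sub>R \<alpha> \<in> cotangent_space M p" if "\<alpha> \<in> cotangent_space M p" for r \<alpha>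
    using that by (simp add: cotangent_space_def scaleR_fun_def distrib_left)
qed

text \<open>A covector is 0 off the tangent space and so need not be linear on the whole type;
  linearity has to be carried through the sum inside the tangent space.\<close>

lemma cotangent_space_sum:
  assumes "subspace (tangent_space M p)" "\<alpha> \<in> cotangent_space M p"
    and "\<And>i. i \<in> I \<Longrightarrow> v i \<in> tangent_space M p"
  shows "\<alpha> (\<Sum>i\<in>I. r i *\<^sub>R v i) = (\<Sum>i\<in>I. r i * \<alpha> (v i))"
proof -
  have add: "\<alpha> (x + y) = \<alpha> x + \<alpha> y" if "x \<in> tangent_space M p" "y \<in> tangent_space M p" for x y
    using assms(2) that unfolding cotangent_space_def by blast
  have scale: "\<alpha> (k *\<^sub>R x) = k * \<alpha> x" if "x \<in> tangent_space M p" for k x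
    using assms(2) that unfolding cotangent_space_def by blast
  have zero: "\<alpha> 0 = 0"
    using scale[OF subspace_0[OF assms(1)], of 0] by simp
  show ?thesis
    using assms(3)
  proof (induction I rule: infinite_finite_induct)
    case (insert i I)
    have "(\<Sum>i\<in>I. r i *\<^sub>R v i) \<in> tangent_space M p"
      using insert.prems by (intro subspace_sum[OF assms(1)] subspace_scale[OF assms(1)]) auto
    moreover have "v i \<in> tangent_space M p"
      using insert.prems by simp
    ultimately have "\<alpha> (r i *\<^sub>R v i + (\<Sum>i\<in>I. r i *\<^sub>R v i))
        = r i * \<alpha> (v i) + \<alpha> (\<Sum>i\<in>I. r i *\<^sub>R v i)"
      by (subst add) (simp_all only: scale subspace_scale[OF assms(1)])
    moreover have "\<alpha> (\<Sum>i\<in>I. r i *\<^sub>R v i) = (\<Sum>i\<in>I. r i * \<alpha> (v i))"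
      using insert.prems by (intro insert.IH) simp
    ultimately show ?case
      unfolding sum.insert[OF insert.hyps(1,2)] by (simp only:)
  qed (simp_all add: zero)
qed

text \<open>Makes dimensions measured through chart components independent of the chart, so that
  different points near \<open>p\<close> can be treated in one chart. Each transition map gives one
  inequality.\<close>

lemma dim_coord_image:
  assumes "smooth_manifold M" "c \<in> charts_at M p" "d \<in> charts_at M p" "A \<subseteq> tangent_space M p"
  shows "dim ((\<lambda>v. v d) ` A) = dim ((\<lambda>v. v c) ` A)"
proof (rule antisym)
  have le: "dim ((\<lambda>v. v d) ` A) \<le> dim ((\<lambda>v. v c) ` A)"
    if "c \<in> charts_at M p" "d \<in> charts_at M p" for c d
  proof -
    have "v d = chart_deriv c (snd d) p (v c)" if "v \<in> A" for v
      using assms(4) that \<open>c \<in> charts_at M p\<close> \<open>d \<in> charts_at M p\<close>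
      unfolding tangent_space_def by blast
    then have "(\<lambda>v. v d) ` A = chart_deriv c (snd d) p ` (\<lambda>v. v c) ` A"
      unfolding image_image by (rule image_cong[OF refl])
    then show ?thesis
      using dim_image_le[OF linear_transition[OF assms(1) that]] by metis
  qed
  show "dim ((\<lambda>v. v d) ` A) \<le> dim ((\<lambda>v. v c) ` A)" "dim ((\<lambda>v. v c) ` A) \<le> dim ((\<lambda>v. v d) ` A)"
    using le assms(2,3) by blast+
qed

text \<open>
  Covectors are identified with vectors of the model space by means of an orthonormal basis \<open>B\<close>
  of it.
\<close>

definition gen_coords ::
  "('a, 'e::euclidean_space) manifold \<Rightarrow> 'e set \<Rightarrow> ('a, 'e) chart \<Rightarrow> 'a
    \<Rightarrow> ('a, 'e) gen_tangent \<Rightarrow> 'e \<times> 'e"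
  where "gen_coords M B c p z = (fst z c, \<Sum>b\<in>B. snd z (coord_vec M c p b) *\<^sub>R b)"

lemma linear_gen_coords: "linear (gen_coords M B c p)"
  by (intro linearI)
    (simp_all add: gen_coords_def scaleR_fun_def scaleR_add_left sum.distrib scaleR_sum_right)

section \<open>The pairing and maximal isotropy in coordinates\<close>

context
  fixes M :: "('a, 'e::euclidean_space) manifold" and B c p
  assumes M: "smooth_manifold M" and c: "c \<in> charts_at M p"
    and B: "B \<subseteq> mmodel M" "\<And>x. x \<in> mmodel M \<Longrightarrow> (\<Sum>b\<in>B. (x \<bullet> b) *\<^sub>R b) = x"
begin

text \<open>By expansion of \<open>v c\<close> in \<open>B\<close>. This justifies the second
  component of \<open>gen_coords\<close>: it represents the covector through the inner
  product.\<close>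

lemma gen_coords_covector:
  assumes "z \<in> gen_tangent_space M p" "v \<in> tangent_space M p"
  shows "snd (gen_coords M B c p z) \<bullet> v c = snd z v"
proof -
  have \<alpha>: "snd z \<in> cotangent_space M p"
    using assms(1) by (auto simp: gen_tangent_space_def)
  have "v = coord_vec M c p (\<Sum>b\<in>B. (v c \<bullet> b) *\<^sub>R b)"
    using B(2)[OF tangent_coord_mem[OF M c assms(2)]] coord_vec_of_tangent[OF M c assms(2)] by simp
  also have "\<dots> = (\<Sum>b\<in>B. (v c \<bullet> b) *\<^sub>R coord_vec M c p b)"
    by (simp add: linear_sum[OF linear_coord_vec[OF M c]] linear_scale[OF linear_coord_vec[OF M c]])
  finally have "snd z v = snd z (\<Sum>b\<in>B. (v c \<bullet> b) *\<^sub>R coord_vec M c p b)"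
    by (rule arg_cong)
  also have "\<dots> = (\<Sum>b\<in>B. (v c \<bullet> b) * snd z (coord_vec M c p b))"
    using B(1) coord_vec_mem_tangent_space[OF M c]
    by (intro cotangent_space_sum[OF subspace_tangent_space[OF M] \<alpha>]) auto
  also have "\<dots> = snd (gen_coords M B c p z) \<bullet> v c"
    by (simp add: gen_coords_def inner_sum_left inner_sum_right inner_commute[of "v c"] mult.commute)
  finally show ?thesis ..
qed

lemma gen_coords_mem:
  assumes "z \<in> gen_tangent_space M p"
  shows "gen_coords M B c p z \<in> mmodel M \<times> mmodel M"
  using assms B(1) smooth_manifold_subspace[OF M] tangent_coord_mem[OF M c]
  by (auto simp: gen_coords_def gen_tangent_space_def intro!: subspace_sum subspace_scale)

lemma inj_on_gen_coords: "inj_on (gen_coords M B c p) (gen_tangent_space M p)"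
proof (rule inj_onI)
  fix z w assume z: "z \<in> gen_tangent_space M p" and w: "w \<in> gen_tangent_space M p"
    and eq: "gen_coords M B c p z = gen_coords M B c p w"
  have T: "fst z \<in> tangent_space M p" "fst w \<in> tangent_space M p"
    using z w by (auto simp: gen_tangent_space_def)
  have "fst z c = fst w c"
    using eq by (simp add: gen_coords_def)
  then have "fst z = fst w"
    using coord_vec_of_tangent[OF M c T(1)] coord_vec_of_tangent[OF M c T(2)] by metis
  moreover have "snd z v = snd w v" for v
  proof (cases "v \<in> tangent_space M p")
    case True
    then show ?thesis
      using gen_coords_covector[OF z True] gen_coords_covector[OF w True] eq by simp
  next
    case False
    then have "snd z v = 0" "snd w v = 0"
      using z w unfolding gen_tangent_space_def cotangent_space_def by auto
    then show ?thesis by simp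
  qed
  then have "snd z = snd w" ..
  ultimately show "z = w"
    by (rule prod_eqI)
qed

lemma pairing_gen_coords:
  assumes "z \<in> gen_tangent_space M p" "w \<in> gen_tangent_space M p"
  shows "2 * pairing z w =
    snd (gen_coords M B c p z) \<bullet> fst (gen_coords M B c p w) +
    snd (gen_coords M B c p w) \<bullet> fst (gen_coords M B c p z)"
proof -
  have "fst z \<in> tangent_space M p" "fst w \<in> tangent_space M p"
    using assms by (auto simp: gen_tangent_space_def)
  then show ?thesis
    using gen_coords_covector[OF assms(1)] gen_coords_covector[OF assms(2)]
    by (simp add: pairing_def) (simp add: gen_coords_def)
qed

text \<open>The covector \<open>\<beta>\<close> represented by \<open>b\<close>, placed over the
  zero vector, pairs to 0 with itself and with \<open>A\<close>. So \<open>A\<close> plus its line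
  is still isotropic, and maximality absorbs the line.\<close>

lemma maximal_isotropic_annihilator:
  assumes A: "maximal_isotropic M p A" and b: "b \<in> mmodel M"
    and ann: "\<And>v. v \<in> fst ` A \<Longrightarrow> b \<bullet> v c = 0"
  shows "(0, b) \<in> gen_coords M B c p ` A"
proof -
  note T = subspace_tangent_space[OF M, of p]
  define \<beta> where "\<beta> v = (if v \<in> tangent_space M p then b \<bullet> v c else 0)" for v
  have A': "subspace A" "A \<subseteq> gen_tangent_space M p" "isotropic A"
    using A by (auto simp: maximal_isotropic_def)
  have \<beta>: "\<beta> \<in> cotangent_space M p"
    unfolding cotangent_space_def
  proof (intro CollectI conjI ballI allI impI)
    show "\<beta> (v + w) = \<beta> v + \<beta> w" if "v \<in> tangent_space M p" "w \<in> tangent_space M p" for v w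
      using subspace_add[OF T that] that linear_add[OF linear_eval[of c], of v w]
      by (simp only: \<beta>_def if_True inner_add_right)
    show "\<beta> (k *\<^sub>R v) = k * \<beta> v" if "v \<in> tangent_space M p" for k v
      using subspace_scale[OF T that, of k] that linear_scale[OF linear_eval[of c], of k v]
      by (simp only: \<beta>_def if_True inner_scaleR_right)
    show "\<beta> v = 0" if "v \<notin> tangent_space M p" for v
      using that by (simp only: \<beta>_def if_False)
  qed
  then have z: "(0, \<beta>) \<in> gen_tangent_space M p"
    using subspace_0[OF T] by (simp add: gen_tangent_space_def)
  have gen: "subspace (gen_tangent_space M p)"
    unfolding gen_tangent_space_def using T subspace_cotangent_space by (rule subspace_Times)
  define A1 where "A1 = {u + w |u w. u \<in> span {(0, \<beta>)} \<and> w \<in> A}"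
  have "subspace A1"
    unfolding A1_def using A'(1) by (intro subspace_sums subspace_span)
  moreover have "A1 \<subseteq> gen_tangent_space M p"
  proof
    fix x assume "x \<in> A1"
    then obtain u w where uw: "x = u + w" "u \<in> span {(0, \<beta>)}" "w \<in> A"
      unfolding A1_def by blast
    have "span {(0, \<beta>)} \<subseteq> gen_tangent_space M p"
      using z by (intro span_minimal gen) simp
    then show "x \<in> gen_tangent_space M p"
      unfolding uw(1) using uw(2,3) A'(2) by (blast intro: subspace_add[OF gen])
  qed
  moreover have "isotropic A1"
    unfolding isotropic_def
  proof (intro ballI)
    fix z1 z2 assume "z1 \<in> A1" "z2 \<in> A1"
    then obtain k1 w1 k2 w2 where z12: "z1 = k1 *\<^sub>R (0, \<beta>) + w1" "z2 = k2 *\<^sub>R (0, \<beta>) + w2"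
        "w1 \<in> A" "w2 \<in> A"
      unfolding A1_def span_singleton by blast
    have "\<beta> (fst w) = 0" if "w \<in> A" for w
      using ann that by (auto simp: \<beta>_def)
    moreover have "pairing w1 w2 = 0"
      using A'(3) z12 by (auto simp: isotropic_def)
    moreover have "fst z1 = fst w1" "fst z2 = fst w2"
      unfolding z12 by simp_all
    moreover have "snd z1 v = k1 * \<beta> v + snd w1 v" "snd z2 v = k2 * \<beta> v + snd w2 v" for v
      unfolding z12 by (simp_all add: scaleR_fun_def)
    ultimately show "pairing z1 z2 = 0"
      using z12(3,4) by (simp add: pairing_def)
  qed
  moreover have "A \<subseteq> A1" "span {(0, \<beta>)} \<subseteq> A1"
    unfolding A1_def using subset_sum_of_subspaces[OF subspace_span A'(1)] by blast+
  ultimately have "A1 = A"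
    using A unfolding maximal_isotropic_def by blast
  then have "(0, \<beta>) \<in> A"
    using \<open>span {(0, \<beta>)} \<subseteq> A1\<close> span_base[of "(0, \<beta>)"] by blast
  moreover have "gen_coords M B c p (0, \<beta>) = (0, b)"
  proof -
    have "\<beta> (coord_vec M c p e) = b \<bullet> e" if "e \<in> B" for e
      using that B(1) coord_vec_mem_tangent_space[OF M c, of e] coord_vec_coord[OF M c, of e]
      by (auto simp: \<beta>_def)
    then show ?thesis
      using B(2)[OF b] by (simp add: gen_coords_def)
  qed
  ultimately show ?thesis
    by (metis imageI)
qed

end

lemma fst_image_gen_coords: "fst ` gen_coords M B c p ` A = (\<lambda>v. v c) ` fst ` A"
  by (simp add: image_image gen_coords_def)


section \<open>Local constancy of the parity\<close>

lemma openin_coord_ball: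
  assumes "is_chart T F c" "openin T V"
  shows "openin T {q \<in> fst c \<inter> V. dist (snd c q) x < r}"
proof -
  have c: "openin T (fst c)"
    using assms(1) by (simp add: is_chart_def)
  have "continuous_map (subtopology T (fst c)) (top_of_set (snd c ` fst c)) (snd c)"
    using assms(1) homeomorphic_imp_continuous_map unfolding is_chart_def by blast
  then have "continuous_map (subtopology T (fst c)) euclidean (snd c)"
    by (simp add: continuous_map_in_subtopology)
  from openin_continuous_map_preimage[OF this, of "ball x r"]
  have "openin (subtopology T (fst c)) {q \<in> fst c. dist x (snd c q) < r}"
    using openin_subset[OF c] by (simp add: Int_absorb1)
  then have "openin T {q \<in> fst c. dist x (snd c q) < r}"
    using openin_open_subtopology[OF c] by blast
  from openin_Int[OF this assms(2)] show ?thesis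
    by (rule back_subst[of "openin T"]) (auto simp: dist_commute)
qed

lemma continuous_on_gen_coords:
  assumes "smooth_section_on M W s" "c \<in> matlas M" "B \<subseteq> mmodel M"
  shows "continuous_on (snd c ` (fst c \<inter> W))
    (\<lambda>x. gen_coords M B c (chart_inv c x) (s (chart_inv c x)))"
proof -
  have "smooth_on (mmodel M) (snd c ` (fst c \<inter> W)) (\<lambda>x. fst (s (chart_inv c x)) c)"
    using assms(1,2) by (simp add: smooth_section_on_def smooth_vector_field_on_def)
  moreover have "smooth_on (mmodel M) (snd c ` (fst c \<inter> W))
      (\<lambda>x. snd (s (chart_inv c x)) (coord_vec M c (chart_inv c x) b))" if "b \<in> B" for b
    using assms that by (auto simp: smooth_section_on_def smooth_one_form_on_def)
  ultimately show ?thesis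
    unfolding gen_coords_def
    by (intro continuous_on_Pair continuous_on_sum continuous_on_scaleR continuous_on_const)
      (blast intro: smooth_on_continuous_on)+
qed

lemma dirac_distribution_parity_locally_constant:
  fixes M :: "('a, 'e::euclidean_space) manifold"
  assumes M: "smooth_manifold M" and L: "smooth_subbundle M L"
    and max: "\<And>q. q \<in> topspace (mtop M) \<Longrightarrow> maximal_isotropic M q (L q)"
    and p: "p \<in> topspace (mtop M)" and c: "c \<in> charts_at M p"
  obtains G where "openin (mtop M) G" "p \<in> G" "G \<subseteq> fst c"
    "\<And>q. q \<in> G \<Longrightarrow> even (dim ((\<lambda>v. v c) ` dirac_distribution L q))
      \<longleftrightarrow> even (dim ((\<lambda>v. v c) ` dirac_distribution L p))"
proof -
  let ?F = "mmodel M"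
  note F = smooth_manifold_subspace[OF M]
  note chart = smooth_manifold_is_chart[OF M c]
  have atlas: "c \<in> matlas M" "p \<in> fst c"
    using c by (auto simp: charts_at_def)
  obtain B where B: "finite B" "B \<subseteq> ?F" "\<And>x. x \<in> ?F \<Longrightarrow> (\<Sum>b\<in>B. (x \<bullet> b) *\<^sub>R b) = x"
    using orthonormal_expansion[OF F] by blast
  define \<Phi> where "\<Phi> q = gen_coords M B c q" for q
  have lin: "linear (\<Phi> q)" for q
    unfolding \<Phi>_def by (rule linear_gen_coords)
  \<comment> \<open>\<open>D\<close> at \<open>p\<close> in coordinates. It stays fixed while
    \<open>q\<close> varies; E is its orthogonal complement in the model space.\<close>
  define W where "W = fst ` \<Phi> p ` L p"
  have Lp: "subspace (L p)" "L p \<subseteq> gen_tangent_space M p" "isotropic (L p)"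
    using max[OF p] by (auto simp: maximal_isotropic_def)
  have W: "subspace W" "W \<subseteq> ?F"
    using gen_coords_mem[OF M c B(2,3)] Lp(2)
    by (auto simp: W_def \<Phi>_def[symmetric] mem_Times_iff
        intro!: linear_subspace_image[OF linear_fst] linear_subspace_image[OF lin] Lp(1))
  obtain \<pi> where \<pi>: "linear \<pi>" "range \<pi> \<subseteq> W" "\<And>x. x \<in> W \<Longrightarrow> \<pi> x = x"
      "\<And>x. (\<And>w. w \<in> W \<Longrightarrow> x \<bullet> w = 0) \<Longrightarrow> \<pi> x = 0"
    using orthogonal_projection_exists[OF W(1)] by blast
  \<comment> \<open>The kernel of \<open>P\<close> consists of the pairs with first component
    orthogonal to \<open>W\<close> and second in \<open>W\<close>, which is E \<oplus> Ann E. So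
    transversality to \<open>L q\<close> means that \<open>P\<close> is injective on
    \<open>\<Phi> q\<close> followed by restriction to \<open>L q\<close>.\<close>
  define P where "P z = (\<pi> (fst z), snd z - \<pi> (snd z))" for z
  have linP: "linear P"
    using \<pi>(1) by (intro linearI) (simp_all add: P_def linear_add linear_scale algebra_simps)
  from L have "\<forall>p\<in>topspace (mtop M). \<exists>W r (s :: nat \<Rightarrow> 'a \<Rightarrow> ('a, 'e) gen_tangent).
       openin (mtop M) W \<and> p \<in> W \<and>
       (\<forall>i<r. smooth_section_on M W (s i)) \<and>
       (\<forall>q\<in>W. inj_on (\<lambda>i. s i q) {..<r} \<and> independent ((\<lambda>i. s i q) ` {..<r}) \<and>
               span ((\<lambda>i. s i q) ` {..<r}) = L q)"
    unfolding smooth_subbundle_def by (rule conjunct2)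
  from bspec[OF this p] obtain V r and s :: "nat \<Rightarrow> 'a \<Rightarrow> ('a, 'e) gen_tangent"
    where V: "openin (mtop M) V" "p \<in> V"
    and s: "\<forall>i<r. smooth_section_on M V (s i)"
    and frame: "\<forall>q\<in>V. inj_on (\<lambda>i. s i q) {..<r} \<and> independent ((\<lambda>i. s i q) ` {..<r}) \<and>
               span ((\<lambda>i. s i q) ` {..<r}) = L q"
    by (elim exE conjE) (rule that)
  define y where "y i x = P (\<Phi> (chart_inv c x) (s i (chart_inv c x)))" for i x
  let ?x = "snd c p" and ?U = "snd c ` (fst c \<inter> V)"
  have yc: "y i (snd c q) = P (\<Phi> q (s i q))" if "q \<in> fst c" for i q
    using chart_inv_coord[OF chart that] by (simp add: y_def)
  have lin_p: "linear (\<lambda>z. P (\<Phi> p z))"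
    using linear_compose[OF lin linP] by (simp add: o_def)
  have inj: "inj_on (\<lambda>z. P (\<Phi> p z)) (L p)"
  proof (rule inj_onI)
    fix z z' assume z: "z \<in> L p" "z' \<in> L p" and eq: "P (\<Phi> p z) = P (\<Phi> p z')"
    define w where "w = z - z'"
    have w: "w \<in> L p"
      using z Lp(1) by (auto simp: w_def intro: subspace_diff)
    have "P (\<Phi> p w) = 0"
      using eq by (simp add: w_def linear_diff[OF lin_p])
    then have "\<pi> (fst (\<Phi> p w)) = 0" and 2: "snd (\<Phi> p w) = \<pi> (snd (\<Phi> p w))"
      by (simp_all add: P_def prod_eq_iff)
    moreover have "fst (\<Phi> p w) \<in> W"
      using w by (auto simp: W_def)
    ultimately have 1: "fst (\<Phi> p w) = 0"
      using \<pi>(3) by simp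
    \<comment> \<open>Being in \<open>W\<close>, the covector is at the same time the coordinate
      vector of some \<open>u\<close> in \<open>L p\<close>. As the vector part of \<open>w\<close>
      is 0, pairing \<open>w\<close> with \<open>u\<close> yields the squared norm of the
      covector.\<close>
    have "snd (\<Phi> p w) \<in> W"
      using 2 \<pi>(2) by (metis rangeI subsetD)
    then obtain u where u: "u \<in> L p" "snd (\<Phi> p w) = fst (\<Phi> p u)"
      by (auto simp: W_def)
    have "pairing w u = 0"
      using Lp(3) u(1) w by (auto simp: isotropic_def)
    then have "snd (\<Phi> p w) \<bullet> snd (\<Phi> p w) = 0"
      using pairing_gen_coords[OF M c B(2,3), of w u] Lp(2) u w 1 by (auto simp: \<Phi>_def)
    then have "\<Phi> p w = 0"
      using 1 by (simp add: prod_eq_iff)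
    then have "\<Phi> p z = \<Phi> p z'"
      by (simp add: w_def linear_diff[OF lin])
    then show "z = z'"
      using inj_on_gen_coords[OF M c B(2,3)] z Lp(2) by (auto simp: \<Phi>_def dest: inj_onD)
  qed
  have "\<forall>\<^sub>F x in at ?x within ?U.
      \<forall>t. (\<Sum>i\<in>{..<r}. t i *\<^sub>R y i x) = 0 \<longrightarrow> (\<forall>i\<in>{..<r}. t i = (0::real))"
  proof (rule eventually_independent_family)
    note fr = bspec[OF frame V(2)]
    have im: "(\<lambda>i. y i ?x) = (\<lambda>z. P (\<Phi> p z)) \<circ> (\<lambda>i. s i p)"
      using yc[OF atlas(2)] by (simp add: fun_eq_iff)
    show "inj_on (\<lambda>i. y i ?x) {..<r}"
      unfolding im
    proof (rule comp_inj_on)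
      show "inj_on (\<lambda>i. s i p) {..<r}"
        using fr by blast
      have "(\<lambda>i. s i p) ` {..<r} \<subseteq> L p"
        using fr span_superset[of "(\<lambda>i. s i p) ` {..<r}"] by (simp only:)
      then show "inj_on (\<lambda>z. P (\<Phi> p z)) ((\<lambda>i. s i p) ` {..<r})"
        by (rule inj_on_subset[OF inj])
    qed
    show "independent ((\<lambda>i. y i ?x) ` {..<r})"
      unfolding im image_comp[symmetric]
      by (rule linear_independent_injective_image[OF lin_p]) (simp_all only: fr inj not_False_eq_True)
    fix i assume "i \<in> {..<r}"
    then have "continuous_on ?U (\<lambda>x. \<Phi> (chart_inv c x) (s i (chart_inv c x)))"
      unfolding \<Phi>_def using s atlas(1) B(2) by (intro continuous_on_gen_coords) auto
    then have "continuous_on ?U (y i)"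
      unfolding y_def
      by (rule linear_continuous_on_compose[OF _ linP])
    then show "(y i \<longlongrightarrow> y i ?x) (at ?x within ?U)"
      using atlas(2) V(2) by (auto simp: continuous_on_def)
  qed simp
  then obtain \<delta> where \<delta>: "\<delta> > 0" and ind: "\<And>x t. x \<in> ?U \<Longrightarrow> x \<noteq> ?x \<Longrightarrow> dist x ?x < \<delta> \<Longrightarrow>
      (\<Sum>i\<in>{..<r}. t i *\<^sub>R y i x) = 0 \<Longrightarrow> (\<forall>i\<in>{..<r}. t i = (0::real))"
    unfolding eventually_at by blast
  define G where "G = {q \<in> fst c \<inter> V. dist (snd c q) ?x < \<delta>}"
  show ?thesis
  proof
    show "openin (mtop M) G"
      unfolding G_def by (rule openin_coord_ball[OF chart V(1)])
    show "p \<in> G" "G \<subseteq> fst c"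
      using \<delta> V(2) atlas(2) by (auto simp: G_def)
    fix q assume q: "q \<in> G"
    show "even (dim ((\<lambda>v. v c) ` dirac_distribution L q))
      \<longleftrightarrow> even (dim ((\<lambda>v. v c) ` dirac_distribution L p))"
    \<comment> \<open>The filter \<open>at ?x\<close> is punctured, so \<open>p\<close> itself is
      treated apart.\<close>
    proof (cases "snd c q = ?x")
      case True
      then have "q = p"
        using q atlas(2) is_chart_inj[OF chart] by (auto simp: G_def dest: inj_onD)
      then show ?thesis by simp
    next
      case False
      have qV: "q \<in> fst c" "q \<in> V" "q \<in> topspace (mtop M)"
        using q openin_subset[OF V(1)] by (auto simp: G_def)
      have cq: "c \<in> charts_at M q"
        using qV(1) atlas(1) by (simp add: charts_at_def)
      have Lq: "subspace (L q)" "L q \<subseteq> gen_tangent_space M q" "isotropic (L q)"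
        using max[OF qV(3)] by (auto simp: maximal_isotropic_def)
      have "even (dim (fst ` \<Phi> q ` L q)) \<longleftrightarrow> even (dim W)"
      proof (rule lagrangian_projection_parity[OF F W])
        show "subspace (\<Phi> q ` L q)"
          by (rule linear_subspace_image[OF lin Lq(1)])
        show "\<Phi> q ` L q \<subseteq> ?F \<times> ?F"
          using gen_coords_mem[OF M cq B(2,3)] Lq(2) unfolding \<Phi>_def by blast
        show "a \<bullet> y' + b \<bullet> x = 0" if "(x, a) \<in> \<Phi> q ` L q" "(y', b) \<in> \<Phi> q ` L q" for x a y' b
        proof -
          from that obtain z w where zw:
              "z \<in> L q" "(x, a) = \<Phi> q z" "w \<in> L q" "(y', b) = \<Phi> q w"
            by (elim imageE)
          then have "pairing z w = 0"
            using Lq(3) by (auto simp: isotropic_def)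
          then show ?thesis
            using pairing_gen_coords[OF M cq B(2,3), of z w] Lq(2) zw(1,3)
              zw(2)[symmetric] zw(4)[symmetric]
            by (auto simp: \<Phi>_def)
        qed
        show "(0, b) \<in> \<Phi> q ` L q" if "b \<in> ?F" "\<And>y. y \<in> fst ` \<Phi> q ` L q \<Longrightarrow> b \<bullet> y = 0" for b
          unfolding \<Phi>_def
        proof (rule maximal_isotropic_annihilator[OF M cq B(2,3) max[OF qV(3)] that(1)])
          show "b \<bullet> v c = 0" if "v \<in> fst ` L q" for v
            using \<open>\<And>y. y \<in> fst ` \<Phi> q ` L q \<Longrightarrow> b \<bullet> y = 0\<close>[of "v c"] that
            unfolding \<Phi>_def fst_image_gen_coords by blast
        qed
        fix x a assume xa: "(x, a) \<in> \<Phi> q ` L q" "\<And>w. w \<in> W \<Longrightarrow> x \<bullet> w = 0" "a \<in> W"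
        obtain u where u: "u \<in> L q" "\<Phi> q u = (x, a)"
          using xa(1) by (metis imageE)
        \<comment> \<open>An element of \<open>L q\<close> killed by \<open>P\<close> gives a linear
          relation between the images of the frame; near \<open>p\<close> these are independent, so
          the element is 0.\<close>
        have "u \<in> span ((\<lambda>i. s i q) ` {..<r})"
          using bspec[OF frame qV(2)] u(1) by simp
        then obtain k where "u = (\<Sum>z\<in>(\<lambda>i. s i q) ` {..<r}. k z *\<^sub>R z)"
          by (auto simp: span_finite)
        also have "\<dots> = (\<Sum>i\<in>{..<r}. k (s i q) *\<^sub>R s i q)"
          using bspec[OF frame qV(2)] by (subst sum.reindex) auto
        finally have u_eq: "u = (\<Sum>i\<in>{..<r}. k (s i q) *\<^sub>R s i q)" .
        have "(\<Sum>i\<in>{..<r}. k (s i q) *\<^sub>R y i (snd c q)) = P (\<Phi> q u)"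
          by (simp add: u_eq yc[OF qV(1)] linear_sum[OF lin] linear_sum[OF linP]
              linear_scale[OF lin] linear_scale[OF linP])
        also have "\<dots> = 0"
          using u(2) \<pi>(3)[OF xa(3)] \<pi>(4)[OF xa(2)] by (simp add: P_def zero_prod_def)
        finally have "\<forall>i\<in>{..<r}. k (s i q) = 0"
          using ind[of "snd c q" "\<lambda>i. k (s i q)"] False q by (auto simp: G_def)
        then have "u = 0"
          unfolding u_eq by (intro sum.neutral) simp
        then show "x = 0 \<and> a = 0"
          using u(2) linear_0[OF lin] by (simp add: zero_prod_def)
      qed
      then show ?thesis
        by (simp add: W_def \<Phi>_def fst_image_gen_coords dirac_distribution_def)
    qed
  qed
qed


section \<open>Leaves\<close>

text \<open>In a chart of \<open>N\<close> and the chart \<open>d\<close> of \<open>M\<close> the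
  tangent map of the inclusion becomes a linear map \<open>T\<close> that is injective on the model
  space of \<open>N\<close> and has the coordinates of \<open>D p\<close> as image.\<close>

lemma mdim_integral_manifold:
  fixes M N :: "('a, 'e::euclidean_space) manifold"
  assumes M: "smooth_manifold M" and N: "integral_manifold M D N"
    and p: "p \<in> topspace (mtop N)" and d: "d \<in> charts_at M p" and D: "D p \<subseteq> tangent_space M p"
  shows "mdim N = dim ((\<lambda>v. v d) ` D p)"
proof -
  have N': "smooth_manifold N" "smooth_inclusion N M"
      "inj_on (incl_tangent N M p) (tangent_space N p)"
      "incl_tangent N M p ` tangent_space N p = D p"
    using N p by (auto simp: integral_manifold_def immersed_submanifold_def)
  define c where "c = some_chart N p"
  have c: "c \<in> charts_at N p"
    unfolding c_def by (rule some_chart_in_charts_at[OF N'(1) p])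
  note chart = smooth_manifold_is_chart[OF N'(1) c]
  note F = smooth_manifold_subspace[OF N'(1)]
  define T where "T = chart_deriv c (snd d) p"
  have incl: "incl_tangent N M p v d = T (v c)" for v
    using d by (simp add: incl_tangent_def T_def c_def Let_def)
  have pcd: "p \<in> fst c \<inter> fst d"
    using charts_at_mem[OF c] charts_at_mem[OF d] by simp
  have "linear T"
    unfolding T_def
  proof (rule has_derivative_linear[OF chart_deriv_has_derivative[OF chart _ _ pcd]])
    \<comment> \<open>The overlap must be open in the topology of \<open>N\<close> itself, which may
      be finer than the one induced from \<open>M\<close>; continuity of the inclusion provides
      this.\<close>
    have "openin (mtop M) (fst d)"
      using smooth_manifold_is_chart[OF M d] by (simp add: is_chart_def)
    moreover have "continuous_map (mtop N) (mtop M) (\<lambda>p. p)"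
      using N'(2) by (simp add: smooth_inclusion_def)
    ultimately have "openin (mtop N) {q \<in> topspace (mtop N). q \<in> fst d}"
      by (rule openin_continuous_map_preimage[rotated])
    moreover have "openin (mtop N) (fst c)"
      using chart by (simp add: is_chart_def)
    ultimately have "openin (mtop N) (fst c \<inter> {q \<in> topspace (mtop N). q \<in> fst d})"
      by (intro openin_Int)
    moreover have "fst c \<inter> {q \<in> topspace (mtop N). q \<in> fst d} = fst c \<inter> fst d"
      using openin_subset[OF \<open>openin (mtop N) (fst c)\<close>] by auto
    ultimately show "openin (mtop N) (fst c \<inter> fst d)"
      by simp
    have "smooth_on (mmodel N) (snd c ` (fst c \<inter> fst d)) (snd d \<circ> chart_inv c)"
      using N'(2) c d by (auto simp: smooth_inclusion_def charts_at_def)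
    then show "(snd d \<circ> chart_inv c) differentiable (at (snd c p) within snd c ` (fst c \<inter> fst d))"
      using pcd by (intro smooth_on_differentiable) auto
  qed simp
  have coords: "(\<lambda>v. v c) ` tangent_space N p = mmodel N"
    using tangent_coord_mem[OF N'(1) c] coord_vec_mem_tangent_space[OF N'(1) c]
      coord_vec_coord[OF N'(1) c] by (metis (no_types, lifting) image_eqI image_subsetI subsetI subset_antisym)
  have "inj_on T (mmodel N)"
  proof (rule inj_onI)
    fix e e' assume e: "e \<in> mmodel N" "e' \<in> mmodel N" and eq: "T e = T e'"
    let ?v = "coord_vec N c p e" and ?v' = "coord_vec N c p e'"
    have v: "?v \<in> tangent_space N p" "?v' \<in> tangent_space N p"
      using e coord_vec_mem_tangent_space[OF N'(1) c] by auto
    have "incl_tangent N M p ?v d = incl_tangent N M p ?v' d"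
      using eq e by (simp add: incl coord_vec_coord[OF N'(1) c])
    \<comment> \<open>Equality is known only for the component in \<open>d\<close>. It extends to
      all components because a tangent vector of \<open>M\<close> is determined by one of
      them.\<close>
    moreover have "incl_tangent N M p ?v \<in> tangent_space M p" "incl_tangent N M p ?v' \<in> tangent_space M p"
      using v N'(4) D by blast+
    ultimately have "incl_tangent N M p ?v = incl_tangent N M p ?v'"
      using coord_vec_of_tangent[OF M d] by metis
    then have "?v = ?v'"
      using inj_onD[OF N'(3) _ v] by blast
    then show "e = e'"
      using e coord_vec_coord[OF N'(1) c] by metis
  qed
  then have "dim (T ` mmodel N) = dim (mmodel N)"
    using dim_image_eq[OF \<open>linear T\<close>, of "mmodel N"] span_eq_iff[THEN iffD2, OF F] by simp
  moreover have "(\<lambda>v. v d) ` D p = T ` mmodel N"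
    unfolding N'(4)[symmetric] coords[symmetric] image_image incl ..
  ultimately show ?thesis
    by (simp add: mdim_def)
qed

theorem corollary3p3:
  fixes M :: "('a, 'e::euclidean_space) manifold"
    and L :: "'a \<Rightarrow> ('a, 'e) gen_tangent set"
  assumes "smooth_manifold M"
    and "connected_space (mtop M)"
    and "dirac_structure M L"
    and "N1 \<in> presymplectic_foliation M L"
    and "N2 \<in> presymplectic_foliation M L"
  shows "even (mdim N1) \<longleftrightarrow> even (mdim N2)"
proof -
  have L: "smooth_subbundle M L"
    and max: "\<And>q. q \<in> topspace (mtop M) \<Longrightarrow> maximal_isotropic M q (L q)"
    using assms(3) by (auto simp: dirac_structure_def)
  have D: "dirac_distribution L q \<subseteq> tangent_space M q" if "q \<in> topspace (mtop M)" for q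
    using max[OF that]
    by (auto simp: dirac_distribution_def maximal_isotropic_def gen_tangent_space_def)
  \<comment> \<open>The chart chosen here varies wildly with \<open>q\<close>; by
    \<open>dim_coord_image\<close> any chart around \<open>q\<close> gives the same number.\<close>
  define dimD where "dimD q = dim ((\<lambda>v. v (some_chart M q)) ` dirac_distribution L q)" for q
  have dimD: "dim ((\<lambda>v. v c) ` dirac_distribution L q) = dimD q"
    if "q \<in> topspace (mtop M)" "c \<in> charts_at M q" for q c
    unfolding dimD_def
    using dim_coord_image[OF assms(1) some_chart_in_charts_at[OF assms(1) that(1)] that(2) D[OF that(1)]] .
  have nbhd: "\<exists>G. openin (mtop M) G \<and> p \<in> G \<and> (\<forall>q\<in>G. even (dimD q) \<longleftrightarrow> even (dimD p))"
    if p: "p \<in> topspace (mtop M)" for p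
  proof -
    let ?c = "some_chart M p"
    have c: "?c \<in> charts_at M p"
      using some_chart_in_charts_at[OF assms(1) p] .
    obtain G where G: "openin (mtop M) G" "p \<in> G" "G \<subseteq> fst ?c"
      "\<And>q. q \<in> G \<Longrightarrow> even (dim ((\<lambda>v. v ?c) ` dirac_distribution L q))
        \<longleftrightarrow> even (dim ((\<lambda>v. v ?c) ` dirac_distribution L p))"
      using dirac_distribution_parity_locally_constant[OF assms(1) L max p c] by blast
    have "even (dimD q) \<longleftrightarrow> even (dimD p)" if "q \<in> G" for q
    proof -
      have "q \<in> topspace (mtop M)" "?c \<in> charts_at M q"
        using that G(1,3) c openin_subset by (fastforce simp: charts_at_def)+
      then show ?thesis
        using G(4)[OF that] dimD[OF _ c] p by (simp add: dimD)
    qed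
    then show ?thesis
      using G by blast
  qed
  have parity_open: "openin (mtop M) {p \<in> topspace (mtop M). even (dimD p) = b}" for b
  proof (rule openin_subopen[THEN iffD2], rule ballI)
    fix p assume p: "p \<in> {p \<in> topspace (mtop M). even (dimD p) = b}"
    then obtain G where G: "openin (mtop M) G" "p \<in> G" "\<forall>q\<in>G. even (dimD q) \<longleftrightarrow> even (dimD p)"
      using nbhd[of p] by blast
    then have "G \<subseteq> {p \<in> topspace (mtop M). even (dimD p) = b}"
      using p openin_subset[OF G(1)] by blast
    then show "\<exists>T. openin (mtop M) T \<and> p \<in> T \<and> T \<subseteq> {p \<in> topspace (mtop M). even (dimD p) = b}"
      using G by blast
  qed
  have const: "even (dimD p) \<longleftrightarrow> even (dimD q)"
    if "p \<in> topspace (mtop M)" "q \<in> topspace (mtop M)" for p q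
  proof (rule ccontr)
    \<comment> \<open>The points of even and of odd dimension form two disjoint open sets that cover
      \<open>M\<close>.\<close>
    define A where "A b = {p \<in> topspace (mtop M). even (dimD p) = b}" for b
    assume "\<not> ?thesis"
    then have "A True \<noteq> {}" "A False \<noteq> {}"
      using that by (auto simp: A_def)
    moreover have "topspace (mtop M) \<subseteq> A True \<union> A False" "A True \<inter> A False = {}"
      by (auto simp: A_def)
    moreover have "openin (mtop M) (A b)" for b
      unfolding A_def by (rule parity_open)
    ultimately show False
      using assms(2) unfolding connected_space_def by blast
  qed
  have leaf: "\<exists>p\<in>topspace (mtop M). mdim N = dimD p" if "N \<in> presymplectic_foliation M L" for N
  proof -
    have N: "integral_manifold M (dirac_distribution L) N"
      using that by (simp add: presymplectic_foliation_def leaf_def)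
    then obtain p where p: "p \<in> topspace (mtop N)"
      unfolding integral_manifold_def by blast
    have "continuous_map (mtop N) (mtop M) (\<lambda>p. p)"
      using N by (simp add: integral_manifold_def immersed_submanifold_def smooth_inclusion_def)
    then have pM: "p \<in> topspace (mtop M)"
      using p by (auto simp: continuous_map_def)
    then have "mdim N = dimD p"
      unfolding dimD_def
      by (intro mdim_integral_manifold[OF assms(1) N p] some_chart_in_charts_at[OF assms(1)] D)
    then show ?thesis
      using pM by blast
  qed
  show ?thesis
    using leaf[OF assms(4)] leaf[OF assms(5)] const by metis
qed

end
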